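(* Let $A\in\mathbb{R}_+^{n\times n}$ be an irreducible visualized matrix and let $r\ge T(A)$ be a multiple of $\gamma$. Then the system $A^r\otimes x=A^{r+1}\otimes x$ (in $x\in\mathbb{R}_+^n$) is equivalent to the system of equations $$\bigoplus_{k\in[i]}x_k\oplus\bigoplus_{\mathcal{C}_\nu\neq\mathcal{C}_\mu}\alpha^*_{\mu\nu}\Bigl(\bigoplus_{k\in M_\nu^{(r)}(i)}x_k\Bigr)\oplus\bigoplus_{t\in K^{(r)}(i)}\alpha^*_{\mu\nu(t)}x_t=\bigoplus_{k\in[j]}x_k\oplus\bigoplus_{\mathcal{C}_\nu\neq\mathcal{C}_\mu}\alpha^*_{\mu\nu}\Bigl(\bigoplus_{k\in M_\nu^{(r)}(j)}x_k\Bigr)\oplus\bigoplus_{t\in K^{(r)}(j)}\alpha^*_{\mu\nu(t)}x_t,$$ where $\mathcal{C}_\mu$ is the component of $\mathcal{C}(A)$ which contains both $[i]$ and $[j]$, $\mathcal{C}_\nu$ ranges over the strongly connected components of $\mathcal{C}(A)$ different from $\mathcal{C}_\mu$, and $[i]$ and $[j]$ range over all pairs of cyclic classes such that $[i]\to_1[j]$.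
   Context: Max algebra: on $\mathbb{R}_+=[0,\infty)$ put $a\oplus b=\max(a,b)$, $a\otimes b=ab$, extended to matrices and vectors by $(A\oplus B)_{ij}=\max(a_{ij},b_{ij})$, $(A\otimes B)_{ij}=\max_k a_{ik}b_{kj}$; $A^k$ is the $k$-th max-algebraic power ($A^0=I$), with entries $a^{(k)}_{ij}$. The digraph $\mathcal{D}(A)$ has nodes $1,\dots,n$ and an edge $(i,j)$ of weight $a_{ij}$ iff $a_{ij}\neq 0$; the weight of a path is the product of its edge weights, and the geometric mean of a cycle with $k$ edges is its weight to the power $1/k$. $\lambda(A)$ is the maximum cycle geometric mean. $A$ is definite if $\lambda(A)=1$, and irreducible if for all nodes $i,j$ there is a path in $\mathcal{D}(A)$ from $i$ to $j$. A cycle is critical if its geometric mean equals $\lambda(A)$; the critical graph $\mathcal{C}(A)=(N_c(A),E_c(A))$ consists of all nodes and edges belonging to critical cycles; it is assumed that $N_c(A)=\{1,\dots,c\}$. A matrix $A$ is visualized if it is definite, $a_{ij}\le1$ for all $i,j$ and $a_{ij}=1$ for all $(i,j)\in E_c(A)$. $\mathcal{C}(A)$ has pairwise disjoint strongly connected components $\mathcal{C}_\mu$, $\mu=1,\dots,n_c$, with node sets $N_\mu$ and cyclicities $\gamma_\mu$ (gcd of cycle lengths); $\gamma=\operatorname{lcm}_\mu\gamma_\mu$. For nodes of the same $\mathcal{C}_\mu$, $i\sim j$ if there is a path in $\mathcal{C}_\mu$ from $i$ to $j$ of length $\equiv0\pmod{\gamma_\mu}$; the equivalence classes $[i]$ are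 the cyclic classes, and $[i]\to_t[j]$ means there is a path in $\mathcal{C}_\mu$ from a node of $[i]$ to a node of $[j]$ of length $\equiv t\pmod{\gamma_\mu}$. For a definite $B$, $B^*=I\oplus B\oplus\dots\oplus B^{n-1}$ and $Q(B)$ has entries $q_{ij}=\bigoplus_{k\in N_c(B)}b^*_{ik}b^*_{kj}$. The transient $T(A)$ is an integer such that $A^{t\gamma}=Q(A^\gamma)$ whenever $t\gamma\ge T(A)$, and $A^{r+\gamma}=A^r$ for all $r\ge T(A)$ (it exists for irreducible definite $A$). Core matrix: besides the critical components, each non-critical node $t>c$ is regarded as a component with index $\nu(t)\in\{n_c+1,\dots,n_c+\bar c\}$ and node set $N_{\nu(t)}=\{t\}$, where $\bar c=n-c$. $A^{Core}=(\alpha_{\mu\nu})$, $\mu,\nu=1,\dots,n_c+\bar c$, with $\alpha_{\mu\nu}=\max\{a_{ij}: i\in N_\mu, j\in N_\nu\}$; $\alpha^*_{\mu\nu}$ are the entries of its Kleene star $(A^{Core})^*=I\oplus A^{Core}\oplus\dots\oplus(A^{Core})^{n_c+\bar c-1}$. For $i\in N_\mu$, $\mu\le n_c$, and critical $\nu\ne\mu$: $M^{(r)}_\nu(i)=\{j\in N_\nu: a^{(r)}_{ij}=\alpha^*_{\mu\nu}\}$ and $K^{(r)}(i)=\{t>c: a^{(r)}_{it}=\alpha^*_{\mu\nu(t)}\}$ (these sets depend only on the cyclic class of $i$). *)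

theory Defs
  imports Complex_Main "HOL-Number_Theory.Cong" "Graph_Theory.Graph_Theory"
begin

section \<open>Max algebra over the nonnegative reals\<close>

text \<open>
  Matrices and vectors are real-valued functions on a finite index set \<open>I\<close>; values outside \<open>I\<close>
  play no role. All entries are meant to be nonnegative.

  The sum \<open>max_sum f S\<close> is the finite max-algebraic sum of \<open>f k\<close> over \<open>k \<in> S\<close>. As \<open>0\<close> is the
  neutral element of \<open>max\<close> on the nonnegative reals, it may be inserted without changing a nonempty
  sum, and it is the value of the empty sum.
\<close>

definition max_sum :: "('b \<Rightarrow> real) \<Rightarrow> 'b set \<Rightarrow> real" where
  "max_sum f S = Max (insert 0 (f ` S))"

definition mx_id :: "'a \<Rightarrow> 'a \<Rightarrow> real" where
  "mx_id i j = (if i = j then 1 else 0)"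

definition mx_mult :: "'a set \<Rightarrow> ('a \<Rightarrow> 'a \<Rightarrow> real) \<Rightarrow> ('a \<Rightarrow> 'a \<Rightarrow> real) \<Rightarrow> 'a \<Rightarrow> 'a \<Rightarrow> real" where
  "mx_mult I A B i j = max_sum (\<lambda>k. A i k * B k j) I"

definition mx_vec :: "'a set \<Rightarrow> ('a \<Rightarrow> 'a \<Rightarrow> real) \<Rightarrow> ('a \<Rightarrow> real) \<Rightarrow> 'a \<Rightarrow> real" where
  "mx_vec I A x i = max_sum (\<lambda>k. A i k * x k) I"

primrec mx_pow :: "'a set \<Rightarrow> ('a \<Rightarrow> 'a \<Rightarrow> real) \<Rightarrow> nat \<Rightarrow> 'a \<Rightarrow> 'a \<Rightarrow> real" where
  "mx_pow I A 0 = mx_id"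
| "mx_pow I A (Suc k) = mx_mult I (mx_pow I A k) A"

definition kleene_star :: "'a set \<Rightarrow> ('a \<Rightarrow> 'a \<Rightarrow> real) \<Rightarrow> 'a \<Rightarrow> 'a \<Rightarrow> real" where
  "kleene_star I A i j = max_sum (\<lambda>k. mx_pow I A k i j) {..<card I}"

section \<open>The associated digraph and the critical graph\<close>

definition mx_digraph :: "'a set \<Rightarrow> ('a \<Rightarrow> 'a \<Rightarrow> real) \<Rightarrow> ('a, 'a \<times> 'a) pre_digraph" where
  "mx_digraph I A =
     \<lparr> verts = I, arcs = {(i, j). i \<in> I \<and> j \<in> I \<and> A i j \<noteq> 0}, tail = fst, head = snd \<rparr>"

text \<open>
  Paths are arc walks \<open>pre_digraph.awalk\<close>; they may repeat nodes. Cycles are those of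
  \<open>pre_digraph.cycle\<close>, i.e. nonempty and elementary, with loops allowed. Hence the maximum in
  \<open>max_cycle_mean\<close> is over a finite set; it is \<open>0\<close> for an acyclic digraph. Any closed walk
  decomposes into elementary cycles, so admitting closed walks as cycles would change neither the
  maximum cycle mean, nor the critical graph, nor the cyclicities.
\<close>

definition walk_weight :: "('a \<Rightarrow> 'a \<Rightarrow> real) \<Rightarrow> ('a \<times> 'a) list \<Rightarrow> real" where
  "walk_weight A p = prod_list (map (\<lambda>(i, j). A i j) p)"

definition geo_mean :: "('a \<Rightarrow> 'a \<Rightarrow> real) \<Rightarrow> ('a \<times> 'a) list \<Rightarrow> real" where
  "geo_mean A p = root (length p) (walk_weight A p)"

definition max_cycle_mean :: "'a set \<Rightarrow> ('a \<Rightarrow> 'a \<Rightarrow> real) \<Rightarrow> real" where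
  "max_cycle_mean I A = max_sum (geo_mean A) {p. pre_digraph.cycle (mx_digraph I A) p}"

definition definite :: "'a set \<Rightarrow> ('a \<Rightarrow> 'a \<Rightarrow> real) \<Rightarrow> bool" where
  "definite I A \<longleftrightarrow> max_cycle_mean I A = 1"

definition irreducible_mx :: "'a set \<Rightarrow> ('a \<Rightarrow> 'a \<Rightarrow> real) \<Rightarrow> bool" where
  "irreducible_mx I A \<longleftrightarrow> strongly_connected (mx_digraph I A)"

definition critical_cycle :: "'a set \<Rightarrow> ('a \<Rightarrow> 'a \<Rightarrow> real) \<Rightarrow> ('a \<times> 'a) list \<Rightarrow> bool" where
  "critical_cycle I A p \<longleftrightarrow>
     pre_digraph.cycle (mx_digraph I A) p \<and> geo_mean A p = max_cycle_mean I A"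

definition critical_edges :: "'a set \<Rightarrow> ('a \<Rightarrow> 'a \<Rightarrow> real) \<Rightarrow> ('a \<times> 'a) set" where
  "critical_edges I A = (\<Union>p \<in> Collect (critical_cycle I A). set p)"

definition critical_nodes :: "'a set \<Rightarrow> ('a \<Rightarrow> 'a \<Rightarrow> real) \<Rightarrow> 'a set" where
  "critical_nodes I A = fst ` critical_edges I A \<union> snd ` critical_edges I A"

definition critical_graph :: "'a set \<Rightarrow> ('a \<Rightarrow> 'a \<Rightarrow> real) \<Rightarrow> ('a, 'a \<times> 'a) pre_digraph" where
  "critical_graph I A =
     \<lparr> verts = critical_nodes I A, arcs = critical_edges I A, tail = fst, head = snd \<rparr>"

definition visualized :: "'a set \<Rightarrow> ('a \<Rightarrow> 'a \<Rightarrow> real) \<Rightarrow> bool" where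
  "visualized I A \<longleftrightarrow> definite I A \<and> (\<forall>i\<in>I. \<forall>j\<in>I. A i j \<le> 1) \<and>
     (\<forall>(i, j) \<in> critical_edges I A. A i j = 1)"

section \<open>Critical components and cyclic classes\<close>

text \<open>A component of the critical graph is represented by its node set \<open>N\<close>.\<close>

definition critical_comps :: "'a set \<Rightarrow> ('a \<Rightarrow> 'a \<Rightarrow> real) \<Rightarrow> 'a set set" where
  "critical_comps I A = pre_digraph.sccs_verts (critical_graph I A)"

definition comp_graph :: "'a set \<Rightarrow> ('a \<Rightarrow> 'a \<Rightarrow> real) \<Rightarrow> 'a set \<Rightarrow> ('a, 'a \<times> 'a) pre_digraph" where
  "comp_graph I A N = induce_subgraph (critical_graph I A) N"

definition comp_cyclicity :: "'a set \<Rightarrow> ('a \<Rightarrow> 'a \<Rightarrow> real) \<Rightarrow> 'a set \<Rightarrow> nat" where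
  "comp_cyclicity I A N = Gcd {length p | p. pre_digraph.cycle (comp_graph I A N) p}"

definition cyclicity :: "'a set \<Rightarrow> ('a \<Rightarrow> 'a \<Rightarrow> real) \<Rightarrow> nat" where
  "cyclicity I A = Lcm (comp_cyclicity I A ` critical_comps I A)"

definition comp_path ::
  "'a set \<Rightarrow> ('a \<Rightarrow> 'a \<Rightarrow> real) \<Rightarrow> 'a set \<Rightarrow> nat \<Rightarrow> 'a \<Rightarrow> 'a \<Rightarrow> bool" where
  "comp_path I A N t i j \<longleftrightarrow> (\<exists>p. pre_digraph.awalk (comp_graph I A N) i p j \<and>
     [length p = t] (mod comp_cyclicity I A N))"

definition cyclic_class :: "'a set \<Rightarrow> ('a \<Rightarrow> 'a \<Rightarrow> real) \<Rightarrow> 'a set \<Rightarrow> 'a \<Rightarrow> 'a set" where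
  "cyclic_class I A N i = {j. comp_path I A N 0 i j}"

definition class_access ::
  "'a set \<Rightarrow> ('a \<Rightarrow> 'a \<Rightarrow> real) \<Rightarrow> 'a set \<Rightarrow> nat \<Rightarrow> 'a set \<Rightarrow> 'a set \<Rightarrow> bool" where
  "class_access I A N t X Y \<longleftrightarrow> (\<exists>i\<in>X. \<exists>j\<in>Y. comp_path I A N t i j)"

section \<open>The transient\<close>

definition Q_mx :: "'a set \<Rightarrow> ('a \<Rightarrow> 'a \<Rightarrow> real) \<Rightarrow> 'a \<Rightarrow> 'a \<Rightarrow> real" where
  "Q_mx I B i j = max_sum (\<lambda>k. kleene_star I B i k * kleene_star I B k j) (critical_nodes I B)"

definition is_transient :: "'a set \<Rightarrow> ('a \<Rightarrow> 'a \<Rightarrow> real) \<Rightarrow> nat \<Rightarrow> bool" where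
  "is_transient I A T \<longleftrightarrow>
     (\<forall>t. T \<le> t * cyclicity I A \<longrightarrow> (\<forall>i\<in>I. \<forall>j\<in>I.
        mx_pow I A (t * cyclicity I A) i j = Q_mx I (mx_pow I A (cyclicity I A)) i j)) \<and>
     (\<forall>r\<ge>T. \<forall>i\<in>I. \<forall>j\<in>I. mx_pow I A (r + cyclicity I A) i j = mx_pow I A r i j)"

section \<open>The core matrix\<close>

text \<open>
  The core matrix is indexed by the node sets of its components: the critical components and the
  singletons of noncritical nodes.
\<close>

definition core_index :: "'a set \<Rightarrow> ('a \<Rightarrow> 'a \<Rightarrow> real) \<Rightarrow> 'a set set" where
  "core_index I A = critical_comps I A \<union> (\<lambda>t. {t}) ` (I - critical_nodes I A)"

definition core_mx :: "('a \<Rightarrow> 'a \<Rightarrow> real) \<Rightarrow> 'a set \<Rightarrow> 'a set \<Rightarrow> real" where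
  "core_mx A M N = Max {A i j | i j. i \<in> M \<and> j \<in> N}"

definition core_star :: "'a set \<Rightarrow> ('a \<Rightarrow> 'a \<Rightarrow> real) \<Rightarrow> 'a set \<Rightarrow> 'a set \<Rightarrow> real" where
  "core_star I A = kleene_star (core_index I A) (core_mx A)"

text \<open>In the following, \<open>N\<close> is the critical component containing \<open>i\<close>.\<close>

definition M_set ::
  "'a set \<Rightarrow> ('a \<Rightarrow> 'a \<Rightarrow> real) \<Rightarrow> nat \<Rightarrow> 'a set \<Rightarrow> 'a set \<Rightarrow> 'a \<Rightarrow> 'a set" where
  "M_set I A r N N' i = {j \<in> N'. mx_pow I A r i j = core_star I A N N'}"

definition K_set :: "'a set \<Rightarrow> ('a \<Rightarrow> 'a \<Rightarrow> real) \<Rightarrow> nat \<Rightarrow> 'a set \<Rightarrow> 'a \<Rightarrow> 'a set" where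
  "K_set I A r N i = {t \<in> I - critical_nodes I A. mx_pow I A r i t = core_star I A N {t}}"

definition class_side ::
  "'a set \<Rightarrow> ('a \<Rightarrow> 'a \<Rightarrow> real) \<Rightarrow> nat \<Rightarrow> ('a \<Rightarrow> real) \<Rightarrow> 'a set \<Rightarrow> 'a \<Rightarrow> real" where
  "class_side I A r x N i =
     max (max (max_sum x (cyclic_class I A N i))
              (max_sum (\<lambda>N'. core_star I A N N' * max_sum x (M_set I A r N N' i))
                 (critical_comps I A - {N})))
         (max_sum (\<lambda>t. core_star I A N {t} * x t) (K_set I A r N i))"

end

theory Submission
  imports Defs
begin

text \<open>
  For \<open>i\<close> in a critical component \<open>N\<close> and \<open>j\<close> in a component \<open>M\<close> of the core, the core star entry
  \<open>\<alpha>\<^sup>*(N, M)\<close> equals the Kleene star entry \<open>a\<^sup>*(i, j)\<close>, since every component is linked by walks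
  of weight \<open>1\<close>. It bounds \<open>a\<^sup>(\<^sup>m\<^sup>)(i, j)\<close> for every \<open>m\<close> and is attained by some \<open>m \<ge> r\<close>,
  equivalently at \<open>m = r\<close> by some row of \<open>N\<close>. Put \<open>X = A\<^sup>* \<otimes> x\<close>, which is constant on \<open>N\<close>.

  If \<open>A\<^sup>r \<otimes> x = A\<^sup>r\<^sup>+\<^sup>1 \<otimes> x\<close>, then all later powers agree on \<open>x\<close>, so \<open>(A\<^sup>r \<otimes> x)(i) = X(i)\<close>, and the
  terms with \<open>a\<^sup>(\<^sup>r\<^sup>)(i, j) < a\<^sup>*(i, j)\<close> do not contribute to this maximum; what remains is the side of
  \<open>[i]\<close>. Conversely, if the sides agree along \<open>\<rightarrow>\<^sub>1\<close>, they agree on \<open>N\<close>, and their common value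
  dominates every term of \<open>X\<close>; hence \<open>A\<^sup>r \<otimes> x\<close> and \<open>A\<^sup>r\<^sup>+\<^sup>1 \<otimes> x\<close> equal \<open>X\<close> at the critical nodes. The other
  rows follow because \<open>A\<^sup>r = Q(A\<^sup>\<gamma>)\<close> factors through critical nodes.
\<close>

section \<open>Max-algebraic sums, powers and their action on vectors\<close>

lemma max_sum_ge: "finite S \<Longrightarrow> k \<in> S \<Longrightarrow> f k \<le> max_sum f S"
  by (simp add: max_sum_def)

lemma max_sum_nonneg: "finite S \<Longrightarrow> 0 \<le> max_sum f S"
  by (simp add: max_sum_def)

lemma max_sum_le: "finite S \<Longrightarrow> 0 \<le> b \<Longrightarrow> (\<And>k. k \<in> S \<Longrightarrow> f k \<le> b) \<Longrightarrow> max_sum f S \<le> b"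
  by (auto simp: max_sum_def)

text \<open>A nonzero value cannot be the inserted 0, so some summand realizes it. Value 0 is
  therefore split off as a separate case in many proofs below.\<close>

lemma max_sum_attained: "finite S \<Longrightarrow> max_sum f S \<noteq> 0 \<Longrightarrow> \<exists>k\<in>S. f k = max_sum f S"
  unfolding max_sum_def
  using Max_in[of "insert 0 (f ` S)"] by auto

lemma max_sum_cong: "S = S' \<Longrightarrow> (\<And>k. k \<in> S' \<Longrightarrow> f k = g k) \<Longrightarrow> max_sum f S = max_sum g S'"
  unfolding max_sum_def by (metis image_cong)

section \<open>Powers of a nonnegative matrix and their action on vectors\<close>

locale nonneg_mx =
  fixes I :: "'a set" and A :: "'a \<Rightarrow> 'a \<Rightarrow> real"
  assumes fin: "finite I"
    and nonneg: "\<And>i j. i \<in> I \<Longrightarrow> j \<in> I \<Longrightarrow> 0 \<le> A i j"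
begin

abbreviation pow where "pow \<equiv> mx_pow I A"

lemma pow_nonneg: "0 \<le> pow k i j"
  by (cases k) (simp_all add: mx_id_def mx_mult_def max_sum_nonneg fin)

lemma pow_one: "i \<in> I \<Longrightarrow> j \<in> I \<Longrightarrow> pow (Suc 0) i j = A i j"
proof -
  assume i: "i \<in> I" "j \<in> I"
  have "max_sum (\<lambda>k. mx_id i k * A k j) I \<le> A i j"
    by (rule max_sum_le) (auto simp: fin i nonneg mx_id_def)
  moreover have "A i j \<le> max_sum (\<lambda>k. mx_id i k * A k j) I"
    using max_sum_ge[OF fin i(1), of "\<lambda>k. mx_id i k * A k j"] by (simp add: mx_id_def)
  ultimately show ?thesis by (simp add: mx_mult_def)
qed

text \<open>Concatenation: a walk of length \<open>a\<close> into \<open>k\<close> followed by one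
  of length \<open>b\<close> out of \<open>k\<close> is a walk of length
  \<open>a + b\<close>.\<close>

lemma pow_add_ge: "j \<in> I \<Longrightarrow> k \<in> I \<Longrightarrow> pow a i k * pow b k j \<le> pow (a + b) i j"
proof (induction b arbitrary: j)
  case 0
  then show ?case by (auto simp: mx_id_def pow_nonneg)
next
  case (Suc b)
  show ?case
  proof (cases "pow (Suc b) k j = 0")
    case True
    then show ?thesis by (simp add: pow_nonneg del: mx_pow.simps)
  next
    case False
    then obtain l where l: "l \<in> I" "pow b k l * A l j = pow (Suc b) k j"
      using max_sum_attained[OF fin, of "\<lambda>l. pow b k l * A l j"] by (auto simp: mx_mult_def)
    have "pow a i k * pow (Suc b) k j = (pow a i k * pow b k l) * A l j"
      using l by simp
    also have "\<dots> \<le> pow (a + b) i l * A l j"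
      using Suc l by (intro mult_right_mono nonneg) auto
    also have "\<dots> \<le> pow (a + Suc b) i j"
      using max_sum_ge[OF fin l(1), of "\<lambda>l. pow (a + b) i l * A l j"] by (simp add: mx_mult_def)
    finally show ?thesis .
  qed
qed

text \<open>An optimal walk of length \<open>a + b\<close> is cut after \<open>a\<close> edges; both
  pieces are then optimal.\<close>

lemma pow_add_split:
  assumes "i \<in> I" "j \<in> I"
  shows "\<exists>k\<in>I. pow (a + b) i j = pow a i k * pow b k j"
  using assms(2)
proof (induction b arbitrary: j)
  case 0
  then show ?case by (intro bexI[of _ j]) (auto simp: mx_id_def)
next
  case (Suc b)
  show ?case
  proof (cases "pow (a + Suc b) i j = 0")
    case True
    \<comment> \<open>For value 0 any middle index serves, because each product through it lies
      between 0 and the entry.\<close>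
    have "pow a i i * pow (Suc b) i j \<le> pow (a + Suc b) i j"
      by (rule pow_add_ge) (use assms Suc in auto)
    moreover have "0 \<le> pow a i i * pow (Suc b) i j"
      by (intro mult_nonneg_nonneg pow_nonneg)
    ultimately show ?thesis using True assms by (intro bexI[of _ i]) auto
  next
    case False
    then obtain l where l: "l \<in> I" "pow (a + b) i l * A l j = pow (a + Suc b) i j"
      using max_sum_attained[OF fin, of "\<lambda>l. pow (a + b) i l * A l j"] by (auto simp: mx_mult_def)
    obtain k where k: "k \<in> I" "pow (a + b) i l = pow a i k * pow b k l"
      using Suc.IH[OF l(1)] by auto
    have "pow b k l * A l j \<le> pow (Suc b) k j"
      using max_sum_ge[OF fin l(1), of "\<lambda>l. pow b k l * A l j"] by (simp add: mx_mult_def)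
    then have "pow a i k * (pow b k l * A l j) \<le> pow a i k * pow (Suc b) k j"
      by (intro mult_left_mono pow_nonneg)
    then have "pow (a + Suc b) i j \<le> pow a i k * pow (Suc b) k j"
      using l(2) k(2) by (simp del: mx_pow.simps add: mult.assoc)
    moreover have "pow a i k * pow (Suc b) k j \<le> pow (a + Suc b) i j"
      by (rule pow_add_ge) (use k Suc in auto)
    ultimately show ?thesis using k(1) by (intro bexI[of _ k]) auto
  qed
qed

lemma vec_ge: "k \<in> I \<Longrightarrow> pow m i k * x k \<le> mx_vec I (pow m) x i"
  unfolding mx_vec_def using max_sum_ge[OF fin, of k "\<lambda>k. pow m i k * x k"] by simp

lemma vec_nonneg: "0 \<le> mx_vec I B x i"
  unfolding mx_vec_def by (simp add: max_sum_nonneg fin)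

lemma vec_add:
  assumes x: "\<And>k. k \<in> I \<Longrightarrow> 0 \<le> x k" and i: "i \<in> I"
  shows "mx_vec I (pow (a + b)) x i = mx_vec I (pow a) (mx_vec I (pow b) x) i"
proof (rule antisym)
  show "mx_vec I (pow (a + b)) x i \<le> mx_vec I (pow a) (mx_vec I (pow b) x) i"
    unfolding mx_vec_def[of I "pow (a + b)"]
  proof (rule max_sum_le[OF fin vec_nonneg])
    fix j assume j: "j \<in> I"
    obtain k where k: "k \<in> I" "pow (a + b) i j = pow a i k * pow b k j"
      using pow_add_split[OF i j] by blast
    have "pow (a + b) i j * x j = pow a i k * (pow b k j * x j)"
      using k by simp
    also have "\<dots> \<le> pow a i k * mx_vec I (pow b) x k"
      by (intro mult_left_mono vec_ge j pow_nonneg)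
    also have "\<dots> \<le> mx_vec I (pow a) (mx_vec I (pow b) x) i"
      by (rule vec_ge) (fact k)
    finally show "pow (a + b) i j * x j \<le> mx_vec I (pow a) (mx_vec I (pow b) x) i" .
  qed
next
  show "mx_vec I (pow a) (mx_vec I (pow b) x) i \<le> mx_vec I (pow (a + b)) x i"
    unfolding mx_vec_def[of I "pow a"]
  proof (rule max_sum_le[OF fin vec_nonneg])
    fix k assume k: "k \<in> I"
    show "pow a i k * mx_vec I (pow b) x k \<le> mx_vec I (pow (a + b)) x i"
    proof (cases "mx_vec I (pow b) x k = 0")
      case True
      then show ?thesis by (simp add: vec_nonneg)
    next
      case False
      then obtain j where j: "j \<in> I" "pow b k j * x j = mx_vec I (pow b) x k"
        using max_sum_attained[OF fin, of "\<lambda>j. pow b k j * x j"] by (auto simp: mx_vec_def)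
      have "pow a i k * mx_vec I (pow b) x k = (pow a i k * pow b k j) * x j"
        using j by simp
      also have "\<dots> \<le> pow (a + b) i j * x j"
        by (intro mult_right_mono pow_add_ge j k x)
      also have "\<dots> \<le> mx_vec I (pow (a + b)) x i"
        by (rule vec_ge) (fact j)
      finally show ?thesis .
    qed
  qed
qed

end

text \<open>The entries are bounded by \<open>1\<close>, so walks of weight \<open>1\<close> are exactly the walks in \<open>unit_edges\<close>.\<close>

locale subunit_mx = nonneg_mx +
  assumes le_one: "\<And>i j. i \<in> I \<Longrightarrow> j \<in> I \<Longrightarrow> A i j \<le> 1"
begin

definition unit_edges :: "('a \<times> 'a) set" where
  "unit_edges = {(i, j). i \<in> I \<and> j \<in> I \<and> A i j = 1}"

lemma pow_le_one: "i \<in> I \<Longrightarrow> j \<in> I \<Longrightarrow> pow k i j \<le> 1"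
proof (induction k arbitrary: j)
  case (Suc k)
  then show ?case
    by (auto simp: mx_mult_def fin pow_nonneg nonneg le_one intro!: max_sum_le mult_le_one)
qed (simp add: mx_id_def)

text \<open>A product of numbers in the unit interval is 1 only if every factor is 1.\<close>

lemma pow_eq_one_iff:
  assumes i: "i \<in> I"
  shows "j \<in> I \<Longrightarrow> pow k i j = 1 \<longleftrightarrow> (i, j) \<in> unit_edges ^^ k"
proof (induction k arbitrary: j)
  case 0
  then show ?case by (auto simp: mx_id_def)
next
  case (Suc k)
  show ?case
  proof
    assume 1: "pow (Suc k) i j = 1"
    obtain l where l: "l \<in> I" "pow k i l * A l j = 1"
      using max_sum_attained[OF fin, of "\<lambda>l. pow k i l * A l j"] 1 by (auto simp: mx_mult_def)
    have "pow k i l \<le> 1" "A l j \<le> 1" "0 \<le> pow k i l" "0 \<le> A l j"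
      using l Suc i by (auto intro: pow_le_one le_one nonneg pow_nonneg)
    moreover from this have "pow k i l * A l j \<le> pow k i l" "pow k i l * A l j \<le> A l j"
      by (simp_all add: mult_left_le mult_left_le_one_le)
    ultimately have "pow k i l = 1" "A l j = 1" using l by auto
    then show "(i, j) \<in> unit_edges ^^ Suc k"
      using Suc l by (auto simp: unit_edges_def)
  next
    assume "(i, j) \<in> unit_edges ^^ Suc k"
    then obtain l where l: "(i, l) \<in> unit_edges ^^ k" "(l, j) \<in> unit_edges" by auto
    then have "l \<in> I" "A l j = 1" by (auto simp: unit_edges_def)
    with l Suc have "pow k i l * A l j = 1" by simp
    then have "1 \<le> pow (Suc k) i j"
      using max_sum_ge[OF fin \<open>l \<in> I\<close>, of "\<lambda>l. pow k i l * A l j"] by (simp add: mx_mult_def)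
    with pow_le_one[OF i Suc.prems, of "Suc k"] show "pow (Suc k) i j = 1" by linarith
  qed
qed

text \<open>Here \<open>w\<close> lists the nodes of an optimal walk. Omitting the edges between
  positions \<open>s\<close> and \<open>t\<close> cannot lower the weight, as each is at most 1; if
  \<open>w s = w t\<close>, the two remaining pieces fit together.\<close>

lemma pow_path:
  assumes i: "i \<in> I"
  shows "j \<in> I \<Longrightarrow> \<exists>w. (\<forall>s\<le>m. w s \<in> I) \<and>
    (\<forall>t\<le>m. \<forall>s\<le>t. pow m i j \<le> pow s i (w s) * pow (m - t) (w t) j)"
proof (induction m arbitrary: j)
  case 0
  then show ?case using i by (intro exI[of _ "\<lambda>_. i"]) (auto simp: mx_id_def)
next
  case (Suc m)
  obtain l where l: "l \<in> I" "pow (Suc m) i j = pow m i l * A l j"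
    using pow_add_split[OF i Suc.prems, of m "Suc 0"] pow_one Suc.prems by auto
  obtain w where w: "\<forall>s\<le>m. w s \<in> I"
      "\<forall>t\<le>m. \<forall>s\<le>t. pow m i l \<le> pow s i (w s) * pow (m - t) (w t) l"
    using Suc.IH[OF l(1)] by blast
  define v where "v = w(Suc m := j)"
  have A: "0 \<le> A l j" "A l j \<le> 1" using nonneg le_one l Suc.prems by auto
  have "pow (Suc m) i j \<le> pow s i (v s) * pow (Suc m - t) (v t) j" if t: "t \<le> Suc m" "s \<le> t" for s t
  proof (cases "t = Suc m")
    case False
    then have tm: "t \<le> m" using t by simp
    have "pow (Suc m) i j \<le> pow s i (w s) * pow (m - t) (w t) l * A l j"
      unfolding l(2) by (intro mult_right_mono A) (use w tm t in auto)
    also have "\<dots> \<le> pow s i (w s) * pow (Suc m - t) (w t) j"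
      using pow_add_ge[OF Suc.prems l(1), of "m - t" "w t" "Suc 0"] pow_one[OF l(1) Suc.prems] tm
      unfolding mult.assoc by (intro mult_left_mono pow_nonneg) (simp add: Suc_diff_le)
    finally show ?thesis using tm t by (simp add: v_def)
  next
    case True
    \<comment> \<open>The final factor is now the empty walk at \<open>j\<close>, of weight 1, so
      only the initial piece has to be bounded.\<close>
    have "pow (Suc m) i j \<le> pow s i (v s)"
    proof (cases "s = Suc m")
      case False
      then have s: "s \<le> m" using True t by simp
      have "pow (Suc m) i j \<le> pow m i l"
        unfolding l(2) using A by (simp add: mult_left_le pow_nonneg)
      also have "\<dots> \<le> pow s i (w s) * pow (m - m) (w m) l"
        using w s by blast
      also have "\<dots> \<le> pow s i (w s)"
        by (simp add: mx_id_def pow_nonneg)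
      finally show ?thesis using s by (simp add: v_def)
    qed (simp add: v_def)
    then show ?thesis using True by (simp add: v_def mx_id_def del: mx_pow.simps(2))
  qed
  moreover have "\<forall>s\<le>Suc m. v s \<in> I" using w Suc.prems by (auto simp: v_def le_Suc_eq)
  ultimately show ?case by blast
qed

text \<open>The star collects only lengths below \<open>card I\<close>. A longer walk repeats a node
  by pigeonhole, and cutting out the closed part leaves a shorter walk that is no lighter.\<close>

lemma pow_le_kleene_star:
  assumes "i \<in> I" "j \<in> I"
  shows "pow m i j \<le> kleene_star I A i j"
proof (induction m rule: less_induct)
  case (less m)
  show ?case
  proof (cases "m < card I")
    case True
    then show ?thesis unfolding kleene_star_def by (intro max_sum_ge) auto
  next
    case False
    obtain w where w: "\<forall>s\<le>m. w s \<in> I"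
      "\<forall>t\<le>m. \<forall>s\<le>t. pow m i j \<le> pow s i (w s) * pow (m - t) (w t) j"
      using pow_path[OF assms] by blast
    have "\<not> inj_on w {..m}"
    proof
      assume "inj_on w {..m}"
      then have "card {..m} \<le> card I" using w by (intro card_inj_on_le fin) auto
      with False show False by simp
    qed
    then obtain s t where st: "s < t" "t \<le> m" "w s = w t"
      unfolding inj_on_def by (metis atMost_iff nat_neq_iff)
    have "pow m i j \<le> pow s i (w t) * pow (m - t) (w t) j"
      using w st by (metis less_imp_le)
    also have "\<dots> \<le> pow (s + (m - t)) i j"
      using w st assms by (intro pow_add_ge) auto
    also have "\<dots> \<le> kleene_star I A i j"
      by (rule less.IH) (use st in auto)
    finally show ?thesis .
  qed
qed

end

section \<open>Walks and cycles of digraphs on pairs\<close>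

text \<open>A common form for the digraph of a matrix, its critical graph and the components, in
  which walks become relational powers.\<close>

definition rel_digraph :: "'a set \<Rightarrow> ('a \<times> 'a) set \<Rightarrow> ('a, 'a \<times> 'a) pre_digraph" where
  "rel_digraph V R = \<lparr> verts = V, arcs = R, tail = fst, head = snd \<rparr>"

lemma rel_digraph_simps [simp]:
  "verts (rel_digraph V R) = V" "arcs (rel_digraph V R) = R"
  "tail (rel_digraph V R) = fst" "head (rel_digraph V R) = snd"
  by (simp_all add: rel_digraph_def)

lemma wf_rel_digraph: "R \<subseteq> V \<times> V \<Longrightarrow> wf_digraph (rel_digraph V R)"
  by unfold_locales auto

lemma awalk_relpow:
  assumes R: "R \<subseteq> V \<times> V"
  shows "(\<exists>p. pre_digraph.awalk (rel_digraph V R) u p v \<and> length p = k) \<longleftrightarrow>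
    u \<in> V \<and> (u, v) \<in> R ^^ k"
proof (induction k arbitrary: u)
  case 0
  then show ?case by (auto simp: wf_digraph.awalk_Nil_iff[OF wf_rel_digraph[OF R]])
next
  case (Suc k)
  have "(\<exists>p. pre_digraph.awalk (rel_digraph V R) u p v \<and> length p = Suc k) \<longleftrightarrow>
    (\<exists>w. (u, w) \<in> R \<and> (\<exists>p. pre_digraph.awalk (rel_digraph V R) w p v \<and> length p = k))"
  proof -
    have "(\<exists>p. pre_digraph.awalk (rel_digraph V R) u p v \<and> length p = Suc k) \<longleftrightarrow>
      (\<exists>e q. pre_digraph.awalk (rel_digraph V R) u (e # q) v \<and> length q = k)"
      by (simp only: length_Suc_conv) blast
    then show ?thesis
      unfolding wf_digraph.awalk_Cons_iff[OF wf_rel_digraph[OF R]] by force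
  qed
  also have "\<dots> \<longleftrightarrow> u \<in> V \<and> (u, v) \<in> R ^^ Suc k"
    unfolding Suc.IH using R by (auto simp: relpow_commute[symmetric])
  finally show ?case .
qed

lemma reachable_rel_digraph:
  assumes R: "R \<subseteq> V \<times> V"
  shows "u \<rightarrow>\<^sup>*\<^bsub>rel_digraph V R\<^esub> v \<longleftrightarrow> u \<in> V \<and> (u, v) \<in> R\<^sup>*"
  unfolding wf_digraph.reachable_awalk[OF wf_rel_digraph[OF R]] rtrancl_power
  using awalk_relpow[OF R, of u v] by blast

lemma cycle_relpow:
  assumes R: "R \<subseteq> V \<times> V" and c: "pre_digraph.cycle (rel_digraph V R) p"
  shows "\<exists>u\<in>V. (u, u) \<in> R ^^ length p" "p \<noteq> []" "set p \<subseteq> R"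
proof -
  obtain u where u: "pre_digraph.awalk (rel_digraph V R) u p u" "p \<noteq> []"
    using c by (auto simp: pre_digraph.cycle_def)
  show "\<exists>u\<in>V. (u, u) \<in> R ^^ length p" using awalk_relpow[OF R, of u u] u by blast
  show "p \<noteq> []" by fact
  show "set p \<subseteq> R" using u(1) by (auto simp: pre_digraph.awalk_def)
qed

text \<open>An elementary cycle repeats no arc, so it is a distinct list over a finite set.\<close>

lemma finite_cycles:
  assumes "R \<subseteq> V \<times> V" "finite R"
  shows "finite {p. pre_digraph.cycle (rel_digraph V R) p}"
proof (rule finite_subset)
  show "{p. pre_digraph.cycle (rel_digraph V R) p} \<subseteq> {p. set p \<subseteq> R \<and> distinct p}"
    using cycle_relpow(3)[OF assms(1)]
    by (auto simp: wf_digraph.cycle_conv[OF wf_rel_digraph[OF assms(1)]] pre_digraph.awalk_def)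
qed (use assms(2) in \<open>rule finite_subset_distinct\<close>)

lemma cycle_mono:
  assumes "R' \<subseteq> V \<times> V" "R \<subseteq> R'" "V' \<subseteq> V" "R \<subseteq> V' \<times> V'" "pre_digraph.cycle (rel_digraph V' R) p"
  shows "pre_digraph.cycle (rel_digraph V R') p"
proof (rule wf_digraph.subgraph_cycle)
  show "wf_digraph (rel_digraph V R')" using assms by (intro wf_rel_digraph)
  show "subgraph (rel_digraph V' R) (rel_digraph V R')"
    using assms by (auto simp: subgraph_def compatible_def wf_rel_digraph)
qed fact

text \<open>The return walk can be made elementary. Prefixing the edge repeats only the start node,
  so the result is an elementary cycle, possibly a loop.\<close>

lemma cycle_through_edge:
  assumes R: "R \<subseteq> V \<times> V" and e: "(a, b) \<in> R" and b: "(b, a) \<in> R\<^sup>*"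
  shows "\<exists>p. pre_digraph.cycle (rel_digraph V R) p \<and> (a, b) \<in> set p"
proof -
  let ?G = "rel_digraph V R"
  interpret wf_digraph ?G using R by (rule wf_rel_digraph)
  have "b \<rightarrow>\<^sup>*\<^bsub>?G\<^esub> a" using reachable_rel_digraph[OF R] R e b by auto
  then obtain q where q: "apath b q a" using reachable_apath by auto
  then have "awalk b q a" "distinct (awalk_verts b q)" by (auto simp: apath_def)
  then have "awalk a ((a, b) # q) a" using e by (simp add: awalk_Cons_iff)
  moreover have "distinct (tl (awalk_verts a ((a, b) # q)))" using q by (simp add: apath_def)
  ultimately show ?thesis unfolding cycle_def
    by (intro exI[of _ "(a, b) # q"]) auto
qed

text \<open>Both parts use arcs of \<open>p\<close> itself and not merely of \<open>R\<close>; thus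
  the way back along a cycle of unit edges again consists of unit edges.\<close>

lemma awalk_split:
  assumes R: "R \<subseteq> V \<times> V" and w: "pre_digraph.awalk (rel_digraph V R) u p v" and e: "(a, b) \<in> set p"
  shows "(u, a) \<in> (set p)\<^sup>* \<and> (b, v) \<in> (set p)\<^sup>*"
  using w e
proof (induction p arbitrary: u)
  case (Cons f p)
  interpret wf_digraph "rel_digraph V R" using R by (rule wf_rel_digraph)
  have f: "fst f = u" "awalk (snd f) p v" using Cons.prems by (auto simp: awalk_Cons_iff)
  have mono: "(set p)\<^sup>* \<subseteq> (set (f # p))\<^sup>*" by (rule rtrancl_mono) auto
  have uf: "(u, snd f) \<in> (set (f # p))\<^sup>*" using f by (auto intro!: r_into_rtrancl simp: prod_eq_iff)
  have walk: "(w, v) \<in> (set q)\<^sup>*" if "awalk w q v" for w q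
    using that
  proof (induction q arbitrary: w)
    case (Cons g q)
    then have "fst g = w" "(snd g, v) \<in> (set q)\<^sup>*" by (auto simp: awalk_Cons_iff)
    then show ?case
      by (metis converse_rtrancl_into_rtrancl in_mono list.set_intros(1) prod.collapse rtrancl_mono set_subset_Cons)
  qed (simp add: awalk_Nil_iff)
  show ?case
  proof (cases "(a, b) = f")
    case True
    then show ?thesis using f walk[OF f(2)] mono by auto
  next
    case False
    then have "(snd f, a) \<in> (set p)\<^sup>* \<and> (b, v) \<in> (set p)\<^sup>*" using Cons f(2) by auto
    then show ?thesis using uf mono by (meson rtrancl_trans subsetD)
  qed
qed simp

lemma cycle_edge_return:
  assumes R: "R \<subseteq> V \<times> V" and c: "pre_digraph.cycle (rel_digraph V R) p" and e: "(a, b) \<in> set p"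
  shows "(b, a) \<in> (set p)\<^sup>*"
proof -
  obtain u where "pre_digraph.awalk (rel_digraph V R) u p u"
    using c by (auto simp: pre_digraph.cycle_def)
  from awalk_split[OF R this e] show ?thesis by (meson rtrancl_trans)
qed

section \<open>The critical graph of a matrix with entries at most one\<close>

text \<open>The residues of \<open>S\<close> modulo \<open>g\<close> form a subgroup of the integers modulo \<open>g\<close>, hence are generated by one \<open>d\<close>.\<close>

lemma additive_set_dvd:
  fixes S :: "nat set" and g k :: nat
  assumes g: "0 < g" and S0: "0 \<in> S" and add: "\<And>a b. a \<in> S \<Longrightarrow> b \<in> S \<Longrightarrow> a + b \<in> S"
    and k: "\<And>d. (\<And>s. s \<in> S \<Longrightarrow> d dvd s) \<Longrightarrow> d dvd k"
  shows "\<exists>s\<in>S. g dvd k + s"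
proof -
  define H where "H = {h. \<exists>s\<in>S. [s = h] (mod g)}"
  have Hadd: "a + b \<in> H" if "a \<in> H" "b \<in> H" for a b
    using that add cong_add unfolding H_def by blast
  have Hmult: "q * a \<in> H" if "a \<in> H" for a q
  proof (induction q)
    case 0 then show ?case using S0 by (auto simp: H_def intro: cong_refl)
  next
    case (Suc q) then show ?case using Hadd that by simp
  qed
  have gH: "g \<in> H" using S0 by (auto simp: H_def cong_def intro: bexI[of _ 0])
  have Hcong: "b \<in> H" if "a \<in> H" "[a = b] (mod g)" for a b
    using that unfolding H_def by (blast intro: cong_trans)
  have Hdiff: "a - b \<in> H" if "a \<in> H" "b \<in> H" "b \<le> a" for a b
  proof (rule Hcong)
    \<comment> \<open>Subtraction of \<open>b\<close> modulo \<open>g\<close> is replaced by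
      addition of \<open>(g - 1) * b\<close>, which stays within the naturals.\<close>
    show "a + (g - 1) * b \<in> H" by (intro Hadd Hmult that)
    have "a + (g - 1) * b = (a - b) + g * b"
      using g that(3) by (cases g) auto
    then show "[a + (g - 1) * b = a - b] (mod g)" by (simp add: cong_def)
  qed
  define d where "d = (LEAST h. h \<in> H \<and> 0 < h)"
  have d: "d \<in> H" "0 < d" using LeastI[of "\<lambda>h. h \<in> H \<and> 0 < h" g] gH g by (auto simp: d_def)
  have dmin: "d \<le> h" if "h \<in> H" "0 < h" for h
    unfolding d_def using that by (intro Least_le) auto
  have dvd: "d dvd h" if h: "h \<in> H" for h
  proof -
    have "h - h div d * d \<in> H" by (rule Hdiff[OF h]) (auto intro: Hmult d)
    then have "h mod d \<in> H" by (simp add: minus_div_mult_eq_mod)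
    then have "h mod d = 0" using dmin[of "h mod d"] d(2) by (meson leD mod_less_divisor neq0_conv)
    then show ?thesis by auto
  qed
  have "d dvd k" by (rule k) (use dvd in \<open>auto simp: H_def intro: cong_refl\<close>)
  then have "k \<in> H" using Hmult[OF d(1), of "k div d"] by simp
  \<comment> \<open>This is the residue of \<open>-k\<close>, the correction that makes
    \<open>k + s\<close> divisible by \<open>g\<close>.\<close>
  then have "(g - 1) * k \<in> H" by (rule Hmult)
  then obtain s where s: "s \<in> S" "[s = (g - 1) * k] (mod g)" by (auto simp: H_def)
  have "[k + s = k + (g - 1) * k] (mod g)" using s(2) by (intro cong_add) auto
  also have "k + (g - 1) * k = g * k" using g by (cases g) auto
  finally have "g dvd k + s" by (simp add: cong_def dvd_eq_mod_eq_0)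
  with s(1) show ?thesis by blast
qed

section \<open>Unit edges and critical cycles\<close>

context subunit_mx
begin

abbreviation nz where "nz \<equiv> {(i, j). i \<in> I \<and> j \<in> I \<and> A i j \<noteq> 0}"

lemma nz_subset: "nz \<subseteq> I \<times> I" by auto

lemma unit_edges_subset: "unit_edges \<subseteq> I \<times> I" "unit_edges \<subseteq> nz"
  by (auto simp: unit_edges_def)

lemma mx_digraph_eq: "mx_digraph I A = rel_digraph I nz"
  by (simp add: mx_digraph_def rel_digraph_def)

text \<open>The three claims share one induction, since the characterization of weight 1 relies on
  the bounds for the rest of the walk.\<close>

lemma walk_weight_unit:
  assumes "set p \<subseteq> I \<times> I"
  shows "0 \<le> walk_weight A p" "walk_weight A p \<le> 1"
    "walk_weight A p = 1 \<longleftrightarrow> set p \<subseteq> unit_edges"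
  using assms
proof (induction p)
  case Nil
  case 1 then show ?case by (simp add: walk_weight_def)
  case 2 then show ?case by (simp add: walk_weight_def)
  case 3 then show ?case by (simp add: walk_weight_def)
next
  case (Cons e p)
  obtain a b where e: "e = (a, b)" by force
  have W: "walk_weight A (e # p) = A a b * walk_weight A p" by (simp add: walk_weight_def e)
  {
    assume s: "set (e # p) \<subseteq> I \<times> I"
    have "0 \<le> A a b" "A a b \<le> 1" using s nonneg le_one by (auto simp: e)
    moreover have "0 \<le> walk_weight A p" "walk_weight A p \<le> 1" using Cons s by auto
    moreover from calculation have "A a b * walk_weight A p \<le> A a b"
      "A a b * walk_weight A p \<le> walk_weight A p"
      by (simp_all add: mult_left_le mult_left_le_one_le)
    ultimately have "0 \<le> walk_weight A (e # p)" "walk_weight A (e # p) \<le> 1"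
      "walk_weight A (e # p) = 1 \<longleftrightarrow> A a b = 1 \<and> walk_weight A p = 1"
      unfolding W by auto
    moreover have "(A a b = 1 \<and> walk_weight A p = 1) \<longleftrightarrow> set (e # p) \<subseteq> unit_edges"
      using Cons(3) s by (auto simp: e unit_edges_def)
    ultimately have "0 \<le> walk_weight A (e # p)" "walk_weight A (e # p) \<le> 1"
      "walk_weight A (e # p) = 1 \<longleftrightarrow> set (e # p) \<subseteq> unit_edges" by blast+
  }
  note * = this
  case 1 then show ?case by (rule *)
  case 2 then show ?case by (rule *)
  case 3 then show ?case by (rule *)
qed

lemma geo_mean_unit:
  assumes "set p \<subseteq> I \<times> I" "p \<noteq> []"
  shows "geo_mean A p \<le> 1" "geo_mean A p = 1 \<longleftrightarrow> set p \<subseteq> unit_edges"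
  using walk_weight_unit[OF assms(1)] assms(2)
  by (auto simp: geo_mean_def real_root_eq_1_iff real_root_le_1_iff)

lemma cycle_walk: "pre_digraph.cycle (mx_digraph I A) p \<Longrightarrow> set p \<subseteq> I \<times> I \<and> p \<noteq> []"
  unfolding mx_digraph_eq using cycle_relpow[OF nz_subset] by blast

lemma finite_mx_cycles: "finite {p. pre_digraph.cycle (mx_digraph I A) p}"
  unfolding mx_digraph_eq
  by (intro finite_cycles nz_subset finite_subset[OF nz_subset] finite_cartesian_product fin)

lemma unit_edge_on_cycle:
  assumes "(a, b) \<in> unit_edges" "(b, a) \<in> unit_edges\<^sup>*"
  shows "\<exists>p. pre_digraph.cycle (mx_digraph I A) p \<and> geo_mean A p = 1 \<and> (a, b) \<in> set p"
proof -
  obtain p where p: "pre_digraph.cycle (rel_digraph I unit_edges) p" "(a, b) \<in> set p"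
    using cycle_through_edge[OF unit_edges_subset(1) assms] by blast
  have c: "pre_digraph.cycle (mx_digraph I A) p" unfolding mx_digraph_eq
    by (rule cycle_mono[OF nz_subset unit_edges_subset(2) order_refl unit_edges_subset(1) p(1)])
  have "set p \<subseteq> unit_edges" using cycle_relpow(3)[OF unit_edges_subset(1) p(1)] .
  then show ?thesis using c p(2) geo_mean_unit(2) cycle_walk[OF c] by blast
qed

text \<open>A criterion to be applied to powers of the given matrix, whose definiteness has to be
  derived.\<close>

lemma closed_unit_walk_definite:
  assumes "(k, k) \<in> unit_edges\<^sup>+"
  shows "definite I A"
proof -
  obtain l where l: "(k, l) \<in> unit_edges" "(l, k) \<in> unit_edges\<^sup>*"
    using assms by (meson tranclD)
  then obtain p where p: "pre_digraph.cycle (mx_digraph I A) p" "geo_mean A p = 1"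
    using unit_edge_on_cycle by blast
  have "max_cycle_mean I A \<le> 1" unfolding max_cycle_mean_def
    by (rule max_sum_le[OF finite_mx_cycles]) (use cycle_walk geo_mean_unit in auto)
  moreover have "1 \<le> max_cycle_mean I A" unfolding max_cycle_mean_def
    using max_sum_ge[OF finite_mx_cycles, of p "geo_mean A"] p by simp
  ultimately show ?thesis by (simp add: definite_def)
qed

text \<open>With maximum cycle mean 1 and entries at most 1, a cycle is critical exactly if all its
  edges are unit edges. This replaces cycles by reachability in a relation.\<close>

lemma critical_edges_eq:
  assumes "definite I A"
  shows "critical_edges I A = {(a, b). (a, b) \<in> unit_edges \<and> (b, a) \<in> unit_edges\<^sup>*}"
proof -
  have "(a, b) \<in> unit_edges \<and> (b, a) \<in> unit_edges\<^sup>*"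
    if p: "pre_digraph.cycle (mx_digraph I A) p" "geo_mean A p = 1" "(a, b) \<in> set p" for a b p
  proof -
    have "set p \<subseteq> unit_edges" using p geo_mean_unit(2) cycle_walk by blast
    moreover have "(b, a) \<in> (set p)\<^sup>*"
      using cycle_edge_return[OF nz_subset] p unfolding mx_digraph_eq by blast
    ultimately show ?thesis using p(3) rtrancl_mono by blast
  qed
  then show ?thesis
    using assms unit_edge_on_cycle
    unfolding critical_edges_def critical_cycle_def definite_def by fastforce
qed

lemma definite_closed_unit_walk:
  assumes "definite I A"
  shows "\<exists>k. (k, k) \<in> unit_edges\<^sup>+"
proof -
  obtain p where p: "pre_digraph.cycle (mx_digraph I A) p" "geo_mean A p = 1"
    using max_sum_attained[OF finite_mx_cycles, of "geo_mean A"] assms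
    by (auto simp: max_cycle_mean_def definite_def)
  then obtain a b where ab: "(a, b) \<in> set p" using cycle_walk by (metis list.set_intros(1) neq_Nil_conv surj_pair)
  then have "(a, b) \<in> critical_edges I A"
    using p assms by (auto simp: critical_edges_def critical_cycle_def definite_def)
  then show ?thesis unfolding critical_edges_eq[OF assms] by (auto intro: rtrancl_into_trancl2)
qed

end

section \<open>Components of the critical graph\<close>

locale definite_mx = subunit_mx +
  assumes definite: "definite I A"
begin

abbreviation Ec where "Ec \<equiv> critical_edges I A"
abbreviation Nc where "Nc \<equiv> critical_nodes I A"
abbreviation comps where "comps \<equiv> critical_comps I A"
abbreviation \<gamma> where "\<gamma> \<equiv> cyclicity I A"

lemma Ec_iff: "(a, b) \<in> Ec \<longleftrightarrow> (a, b) \<in> unit_edges \<and> (b, a) \<in> unit_edges\<^sup>*"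
  by (simp add: critical_edges_eq[OF definite])

lemma Ec_subset: "Ec \<subseteq> unit_edges" "Ec \<subseteq> Nc \<times> Nc"
  by (auto simp: Ec_iff critical_nodes_def intro: rev_image_eqI)

lemma Nc_subset: "Nc \<subseteq> I"
  using Ec_subset(1) unit_edges_subset(1) by (auto simp: critical_nodes_def)

text \<open>The walk closes up through unit edges, so each of its edges lies on a closed unit
  walk.\<close>

lemma unit_walk_critical:
  assumes "(i, j) \<in> unit_edges ^^ k" "(j, i) \<in> unit_edges\<^sup>*"
  shows "(i, j) \<in> Ec ^^ k"
  using assms
proof (induction k arbitrary: j)
  case (Suc k)
  then obtain l where l: "(i, l) \<in> unit_edges ^^ k" "(l, j) \<in> unit_edges" by auto
  have "(l, i) \<in> unit_edges\<^sup>*" using l(2) Suc.prems(2) by (rule converse_rtrancl_into_rtrancl)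
  then have "(i, l) \<in> Ec ^^ k" using Suc.IH l(1) by blast
  moreover have "(j, l) \<in> unit_edges\<^sup>*"
    using Suc.prems(2) relpow_imp_rtrancl[OF l(1)] by (rule rtrancl_trans)
  then have "(l, j) \<in> Ec" using l(2) by (simp add: Ec_iff)
  ultimately show ?case by auto
qed simp

lemma Ec_rtrancl_unit: "(i, j) \<in> Ec\<^sup>* \<Longrightarrow> (i, j) \<in> unit_edges\<^sup>*"
  using rtrancl_mono[OF Ec_subset(1)] by blast

lemma Ec_relpow_unit: "(i, j) \<in> Ec ^^ k \<Longrightarrow> (i, j) \<in> unit_edges ^^ k"
  using Ec_subset(1) by (induction k arbitrary: j) auto

text \<open>Every critical edge lies on a critical cycle. Hence reachability in the critical graph
  is symmetric, and its components are the classes of \<open>Ec\<^sup>*\<close>.\<close>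

lemma Ec_return: "(i, j) \<in> Ec\<^sup>* \<Longrightarrow> (j, i) \<in> Ec\<^sup>*"
proof (induction rule: rtrancl_induct)
  case (step y z)
  have "(z, y) \<in> unit_edges\<^sup>*" "(y, z) \<in> unit_edges\<^sup>*" using step(2) by (auto simp: Ec_iff)
  then have "(z, y) \<in> Ec\<^sup>*" by (meson rtrancl_power unit_walk_critical)
  then show ?case using step.IH by (rule rtrancl_trans)
qed simp

lemma critical_graph_eq: "critical_graph I A = rel_digraph Nc Ec"
  by (simp add: critical_graph_def rel_digraph_def)

lemma reach_critical: "i \<rightarrow>\<^sup>*\<^bsub>critical_graph I A\<^esub> j \<longleftrightarrow> i \<in> Nc \<and> (i, j) \<in> Ec\<^sup>*"
  unfolding critical_graph_eq by (rule reachable_rel_digraph[OF Ec_subset(2)])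

lemma comp_subset: "N \<in> comps \<Longrightarrow> N \<subseteq> Nc"
  unfolding critical_comps_def pre_digraph.sccs_verts_def reach_critical by auto

lemma comp_subset_I: "N \<in> comps \<Longrightarrow> N \<subseteq> I"
  using comp_subset Nc_subset by blast

lemma comp_nonempty: "N \<in> comps \<Longrightarrow> N \<noteq> {}"
  unfolding critical_comps_def pre_digraph.sccs_verts_def by auto

lemma comp_reach: "N \<in> comps \<Longrightarrow> i \<in> N \<Longrightarrow> j \<in> N \<longleftrightarrow> (i, j) \<in> Ec\<^sup>*"
proof -
  assume N: "N \<in> comps" and i: "i \<in> N"
  have "(i, j) \<in> Ec\<^sup>* \<Longrightarrow> j \<in> Nc"
    using comp_subset[OF N] i Ec_subset(2) by (auto elim: rtranclE)
  then show ?thesis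
    using N i Ec_return[of i j] unfolding critical_comps_def pre_digraph.sccs_verts_def reach_critical
    by blast
qed

lemma node_in_comp: "i \<in> Nc \<Longrightarrow> \<exists>N\<in>comps. i \<in> N"
proof (intro bexI)
  assume i: "i \<in> Nc"
  have Nc: "(i, j) \<in> Ec\<^sup>* \<Longrightarrow> j \<in> Nc" for j
    using i Ec_subset(2) by (auto elim: rtranclE)
  show "{j. (i, j) \<in> Ec\<^sup>*} \<in> comps"
    unfolding critical_comps_def pre_digraph.sccs_verts_def reach_critical
    using Nc by (auto dest: Ec_return) (meson Ec_return rtrancl_trans)+
qed simp

lemma comp_unique: "N \<in> comps \<Longrightarrow> N' \<in> comps \<Longrightarrow> i \<in> N \<Longrightarrow> i \<in> N' \<Longrightarrow> N = N'"
  using comp_reach by blast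

lemma finite_comps: "finite comps"
  by (rule finite_subset[OF _ iffD2[OF finite_Pow_iff fin]]) (use comp_subset_I in auto)

text \<open>Critical edges never leave a component, so cyclic classes can be studied by walks in the
  whole critical graph.\<close>

lemma comp_relpow:
  assumes "N \<in> comps" "i \<in> N"
  shows "(i, j) \<in> (Ec \<inter> N \<times> N) ^^ k \<longleftrightarrow> (i, j) \<in> Ec ^^ k"
proof
  show "(i, j) \<in> Ec ^^ k \<Longrightarrow> (i, j) \<in> (Ec \<inter> N \<times> N) ^^ k"
  proof (induction k arbitrary: j)
    case (Suc k)
    then obtain l where l: "(i, l) \<in> Ec ^^ k" "(l, j) \<in> Ec" by auto
    then have "l \<in> N" "j \<in> N" using comp_reach[OF assms] relpow_imp_rtrancl[OF l(1)]
      by (auto intro: rtrancl_into_rtrancl)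
    then show ?case using l Suc.IH by auto
  qed simp
next
  show "(i, j) \<in> (Ec \<inter> N \<times> N) ^^ k \<Longrightarrow> (i, j) \<in> Ec ^^ k"
    by (induction k arbitrary: j) auto
qed

lemma comp_graph_eq: "comp_graph I A N = rel_digraph N (Ec \<inter> N \<times> N)"
  by (auto simp: comp_graph_def critical_graph_def induce_subgraph_def rel_digraph_def)

lemma comp_path_iff:
  assumes N: "N \<in> comps"
  shows "comp_path I A N t i j \<longleftrightarrow>
    i \<in> N \<and> (\<exists>k. (i, j) \<in> Ec ^^ k \<and> [k = t] (mod comp_cyclicity I A N))"
proof -
  have "comp_path I A N t i j \<longleftrightarrow> (\<exists>k. (\<exists>p. pre_digraph.awalk (comp_graph I A N) i p j \<and> length p = k)
    \<and> [k = t] (mod comp_cyclicity I A N))"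
    by (auto simp: comp_path_def)
  also have "\<dots> \<longleftrightarrow> (\<exists>k. (i \<in> N \<and> (i, j) \<in> Ec ^^ k) \<and> [k = t] (mod comp_cyclicity I A N))"
    unfolding comp_graph_eq using awalk_relpow[of "Ec \<inter> N \<times> N" N i j] comp_relpow[OF N] by auto
  finally show ?thesis by auto
qed

lemma comp_edges:
  assumes N: "N \<in> comps" and i: "i \<in> N"
  shows "\<exists>j\<in>N. (i, j) \<in> Ec" "\<exists>j\<in>N. (j, i) \<in> Ec"
proof -
  have "i \<in> Nc" using comp_subset N i by auto
  then consider j where "(i, j) \<in> Ec" | j where "(j, i) \<in> Ec"
    by (auto simp: critical_nodes_def)
  then have "\<exists>j. (i, j) \<in> Ec \<and> (j, i) \<in> Ec\<^sup>*"
  proof cases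
    case 1 then show ?thesis using Ec_return by blast
  next
    case (2 j)
    \<comment> \<open>The first edge of a walk back from \<open>i\<close> to \<open>j\<close> is the
      outgoing edge; if that walk is empty, the incoming edge is a loop.\<close>
    then have "(i, j) \<in> Ec\<^sup>*" using Ec_return by blast
    then show ?thesis using 2 by (metis Ec_return converse_rtranclE r_into_rtrancl)
  qed
  then obtain j where j: "(i, j) \<in> Ec" "(j, i) \<in> Ec\<^sup>*" by blast
  then show "\<exists>j\<in>N. (i, j) \<in> Ec" using comp_reach[OF N i] by blast
  obtain l where l: "(j, l) \<in> Ec\<^sup>*" "(l, i) \<in> Ec" using j
    by (metis rtrancl.rtrancl_refl rtranclE)
  then have "(i, l) \<in> Ec\<^sup>*" using j by (meson converse_rtrancl_into_rtrancl)
  then show "\<exists>j\<in>N. (j, i) \<in> Ec" using comp_reach[OF N i] l by blast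
qed

lemma comp_predecessor:
  assumes N: "N \<in> comps" and i: "i \<in> N"
  shows "\<exists>j\<in>N. (j, i) \<in> Ec ^^ k"
proof (induction k)
  case (Suc k)
  then obtain j where j: "j \<in> N" "(j, i) \<in> Ec ^^ k" by blast
  obtain l where "l \<in> N" "(l, j) \<in> Ec" using comp_edges(2)[OF N j(1)] by blast
  then show ?case using j(2) by (meson relpow_Suc_I2)
qed (use i in simp)

section \<open>Cyclicities and long critical walks\<close>

lemma cyclicity_pos: "0 < \<gamma>"
proof -
  \<comment> \<open>A cycle through some critical edge of \<open>N\<close> rules out the gcd of the
    empty set, which would be 0.\<close>
  have "comp_cyclicity I A N \<noteq> 0" if N: "N \<in> comps" for N
  proof -
    obtain i where i: "i \<in> N" using comp_nonempty[OF N] by auto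
    obtain j where j: "j \<in> N" "(i, j) \<in> Ec" using comp_edges(1)[OF N i] by auto
    then have "(j, i) \<in> Ec\<^sup>*" using comp_reach[OF N j(1)] i by simp
    then have "(j, i) \<in> (Ec \<inter> N \<times> N)\<^sup>*" using comp_relpow[OF N j(1)] by (metis rtrancl_power)
    then obtain p where p: "pre_digraph.cycle (comp_graph I A N) p" "(i, j) \<in> set p"
      using cycle_through_edge[of "Ec \<inter> N \<times> N" N i j] i j unfolding comp_graph_eq by auto
    then have "length p \<in> {length p |p. pre_digraph.cycle (comp_graph I A N) p}" "length p \<noteq> 0"
      by auto
    then show ?thesis unfolding comp_cyclicity_def by (metis (mono_tags, lifting) Gcd_0_iff singletonD subsetD)
  qed
  then show ?thesis
    unfolding cyclicity_def using finite_comps by (metis (no_types, lifting) Lcm_0_iff finite_imageI imageE neq0_conv)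
qed

text \<open>Closed walks at \<open>i\<close> are prepended to adjust the length: their lengths form
  an additive set whose common divisors divide the cyclicity of \<open>N\<close>, so one of them
  moves \<open>k\<close> to a multiple of the larger \<open>\<gamma>\<close>.\<close>

lemma long_critical_walk:
  assumes N: "N \<in> comps" and i: "i \<in> N" and w: "(i, j) \<in> Ec ^^ k"
    and k: "comp_cyclicity I A N dvd k"
  shows "\<exists>m\<ge>R. \<gamma> dvd m \<and> (i, j) \<in> Ec ^^ m"
proof -
  define S where "S = {s. (i, i) \<in> Ec ^^ s}"
  have add: "a + b \<in> S" if "a \<in> S" "b \<in> S" for a b
    using that relpow_add[of a b Ec] by (auto simp: S_def)
  have 0: "0 \<in> S" by (simp add: S_def)
  have "\<exists>s\<in>S. \<gamma> dvd k + s"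
  proof (rule additive_set_dvd[OF cyclicity_pos 0 add])
    fix d assume d: "\<And>s. s \<in> S \<Longrightarrow> d dvd s"
    have "d dvd comp_cyclicity I A N" unfolding comp_cyclicity_def
    proof (rule Gcd_greatest, safe)
      fix p assume "pre_digraph.cycle (comp_graph I A N) p"
      then obtain u where u: "u \<in> N" "(u, u) \<in> (Ec \<inter> N \<times> N) ^^ length p"
        unfolding comp_graph_eq using cycle_relpow(1)[of "Ec \<inter> N \<times> N" N] by auto
      then have uu: "(u, u) \<in> Ec ^^ length p" using comp_relpow[OF N] by simp
      have "(i, u) \<in> Ec\<^sup>*" "(u, i) \<in> Ec\<^sup>*" using comp_reach[OF N] i u(1) by auto
      then obtain a b where ab: "(i, u) \<in> Ec ^^ a" "(u, i) \<in> Ec ^^ b"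
        by (auto simp: rtrancl_power)
      \<comment> \<open>Two closed walks at \<open>i\<close> through \<open>u\<close>, without and
        with the cycle, have lengths that differ by \<open>length p\<close>.\<close>
      have "a + b \<in> S" using ab relpow_add[of a b Ec] by (auto simp: S_def)
      moreover have "(a + length p) + b \<in> S"
        using ab uu by (auto simp: S_def relpow_add)
      ultimately have "d dvd a + b" "d dvd length p + (a + b)" using d by (auto simp: ac_simps)
      then show "d dvd length p" using dvd_add_left_iff by blast
    qed
    then show "d dvd k" using k by (rule dvd_trans)
  qed auto
  then obtain s where s: "s \<in> S" "\<gamma> dvd k + s" by blast
  have \<gamma>S: "q * s' \<in> S" if "s' \<in> S" for q s'
    by (induction q) (use 0 add that in auto)
  obtain t where t: "t \<in> S" "0 < t"
  proof -
    obtain l where "(i, l) \<in> Ec" "l \<in> N" using comp_edges(1)[OF N i] by auto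
    moreover from this have "(l, i) \<in> Ec\<^sup>*" using comp_reach[OF N] i by auto
    then obtain q where "(l, i) \<in> Ec ^^ q" by (auto simp: rtrancl_power)
    ultimately have "(i, i) \<in> Ec ^^ Suc q" by (blast intro: relpow_Suc_I2)
    then show thesis using that[of "Suc q"] by (simp add: S_def)
  qed
  \<comment> \<open>The term \<open>s\<close> corrects the residue; \<open>R * \<gamma>\<close>
    rounds of the loop of length \<open>t\<close> exceed \<open>R\<close> without changing
    it.\<close>
  define m where "m = (s + (R * \<gamma>) * t) + k"
  have "s + (R * \<gamma>) * t \<in> S" by (intro add s \<gamma>S t)
  then have "(i, j) \<in> Ec ^^ m" using w by (auto simp: S_def m_def relpow_add)
  moreover have "\<gamma> dvd m"
  proof -
    have "m = (k + s) + \<gamma> * (R * t)" by (simp add: m_def)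
    then show ?thesis using s(2) by simp
  qed
  moreover have "R \<le> R * \<gamma> * t" using cyclicity_pos t(2) by (cases "\<gamma> * t") auto
  then have "R \<le> m" unfolding m_def by linarith
  ultimately show ?thesis by blast
qed

end

section \<open>The core matrix and the Kleene star\<close>

context definite_mx
begin

lemma core_index_subset: "M \<in> core_index I A \<Longrightarrow> M \<subseteq> I"
  using comp_subset_I by (auto simp: core_index_def)

lemma core_index_nonempty: "M \<in> core_index I A \<Longrightarrow> M \<noteq> {}"
  using comp_nonempty by (auto simp: core_index_def)

lemma core_index_cover: "i \<in> I \<Longrightarrow> \<exists>M\<in>core_index I A. i \<in> M"
  using node_in_comp by (cases "i \<in> Nc") (auto simp: core_index_def)

lemma core_index_unique:
  "M \<in> core_index I A \<Longrightarrow> N \<in> core_index I A \<Longrightarrow> i \<in> M \<Longrightarrow> i \<in> N \<Longrightarrow> M = N"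
  unfolding core_index_def using comp_unique comp_subset by blast

text \<open>Moving within one index set of the core costs nothing: critical edges have weight 1, and
  a singleton needs only the empty walk.\<close>

lemma core_index_linked:
  assumes "M \<in> core_index I A" "i \<in> M" "j \<in> M"
  shows "\<exists>m. pow m i j = 1"
proof (cases "M \<in> comps")
  case True
  then have "(i, j) \<in> unit_edges\<^sup>*" using comp_reach[OF True assms(2)] assms(3) Ec_rtrancl_unit by blast
  moreover have "i \<in> I" "j \<in> I" using assms core_index_subset by auto
  ultimately show ?thesis by (auto simp: rtrancl_power pow_eq_one_iff)
next
  case False
  then have "i = j" using assms by (auto simp: core_index_def)
  then show ?thesis by (intro exI[of _ 0]) (simp add: mx_id_def)
qed

lemma finite_core_entries:
  "M \<in> core_index I A \<Longrightarrow> N \<in> core_index I A \<Longrightarrow> finite {A i j |i j. i \<in> M \<and> j \<in> N}"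
proof -
  assume MN: "M \<in> core_index I A" "N \<in> core_index I A"
  have "{A i j |i j. i \<in> M \<and> j \<in> N} \<subseteq> (\<lambda>(i, j). A i j) ` (I \<times> I)"
    using MN[THEN core_index_subset] by auto
  then show ?thesis by (rule finite_subset) (simp add: fin)
qed

lemma core_mx_ge:
  "M \<in> core_index I A \<Longrightarrow> N \<in> core_index I A \<Longrightarrow> i \<in> M \<Longrightarrow> j \<in> N \<Longrightarrow> A i j \<le> core_mx A M N"
  unfolding core_mx_def by (rule Max_ge[OF finite_core_entries]) auto

lemma core_mx_attained:
  assumes "M \<in> core_index I A" "N \<in> core_index I A"
  shows "\<exists>i\<in>M. \<exists>j\<in>N. core_mx A M N = A i j"
proof -
  have "{A i j |i j. i \<in> M \<and> j \<in> N} \<noteq> {}"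
    using assms[THEN core_index_nonempty] by blast
  from Max_in[OF finite_core_entries[OF assms] this] show ?thesis by (auto simp: core_mx_def)
qed

sublocale core: subunit_mx "core_index I A" "core_mx A"
proof
  show "finite (core_index I A)"
    by (simp add: core_index_def finite_comps fin)
  show "0 \<le> core_mx A M N" "core_mx A M N \<le> 1"
    if "M \<in> core_index I A" "N \<in> core_index I A" for M N
    using core_mx_attained[OF that] that[THEN core_index_subset] nonneg le_one by (metis subsetD)+
qed

text \<open>A walk is projected to the sets containing its nodes; each edge is bounded by the core
  entry between them. In the base case \<open>i = j\<close> forces \<open>M = N\<close> by
  disjointness.\<close>

lemma pow_le_core_pow:
  assumes M: "M \<in> core_index I A" "i \<in> M"
  shows "N \<in> core_index I A \<Longrightarrow> j \<in> N \<Longrightarrow> pow m i j \<le> core.pow m M N"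
proof (induction m arbitrary: j N)
  case 0
  then show ?case using core_index_unique M by (auto simp: mx_id_def)
next
  case (Suc m)
  have "pow m i l * A l j \<le> core.pow (Suc m) M N" if l: "l \<in> I" for l
  proof -
    obtain L where L: "L \<in> core_index I A" "l \<in> L" using core_index_cover[OF l] by blast
    have "pow m i l * A l j \<le> core.pow m M L * core_mx A L N"
      using Suc L l core_index_subset
      by (intro mult_mono core_mx_ge nonneg core.pow_nonneg) auto
    also have "\<dots> \<le> core.pow (Suc m) M N"
      using max_sum_ge[OF core.fin L(1), of "\<lambda>L. core.pow m M L * core_mx A L N"]
      by (simp add: mx_mult_def)
    finally show ?thesis .
  qed
  then show ?case using core.pow_nonneg[of "Suc m" M N]
    by (simp add: mx_mult_def fin max_sum_le)
qed

text \<open>Each core edge is realized by an edge of \<open>A\<close>, and consecutive ones are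
  joined by unit walks inside a component. These connections are why the length \<open>m\<close> may
  differ from \<open>k\<close>.\<close>

lemma core_pow_le_pow:
  assumes M: "M \<in> core_index I A" "i \<in> M"
  shows "N \<in> core_index I A \<Longrightarrow> j \<in> N \<Longrightarrow> \<exists>m. core.pow k M N \<le> pow m i j"
proof (induction k arbitrary: j N)
  case 0
  then show ?case using core_index_linked M pow_nonneg by (auto simp: mx_id_def) (metis order_refl)
next
  case (Suc k)
  obtain L where L: "L \<in> core_index I A" "core.pow (Suc k) M N = core.pow k M L * core_mx A L N"
    using core.pow_add_split[OF M(1) Suc.prems(1), of k "Suc 0"] core.pow_one Suc.prems by auto
  obtain l n where ln: "l \<in> L" "n \<in> N" "core_mx A L N = A l n"
    using core_mx_attained[OF L(1) Suc.prems(1)] by blast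
  have I: "i \<in> I" "l \<in> I" "n \<in> I" "j \<in> I"
    using core_index_subset M L ln Suc.prems by auto
  obtain m where m: "core.pow k M L \<le> pow m i l" using Suc.IH[OF L(1) ln(1)] by blast
  obtain q where q: "pow q n j = 1" using core_index_linked[OF Suc.prems(1) ln(2)] Suc.prems(2) by blast
  have "core.pow (Suc k) M N \<le> pow m i l * A l n"
    unfolding L(2) ln(3) by (intro mult_right_mono m nonneg I)
  also have "\<dots> \<le> pow (m + Suc 0) i n"
    using pow_add_ge[OF I(3) I(2), of m i "Suc 0"] pow_one[OF I(2,3)] by simp
  also have "\<dots> \<le> pow (m + Suc 0 + q) i j"
    using pow_add_ge[OF I(4) I(3), of "m + Suc 0" i q] q by simp
  finally show ?case by blast
qed

section \<open>Comparison of the two Kleene stars\<close>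

abbreviation star where "star \<equiv> kleene_star I A"

lemma star_attained: "\<exists>m. star i j = 0 \<or> star i j = pow m i j"
  unfolding kleene_star_def
  using max_sum_attained[of "{..<card I}" "\<lambda>k. pow k i j"] by (metis finite_lessThan)

text \<open>Both stars dominate all powers of their matrices, so the change of length in
  \<open>core_pow_le_pow\<close> is harmless.\<close>

lemma core_star_eq:
  assumes M: "M \<in> core_index I A" "i \<in> M" and N: "N \<in> core_index I A" "j \<in> N"
  shows "core_star I A M N = star i j"
proof (rule antisym)
  have I: "i \<in> I" "j \<in> I" using assms core_index_subset by auto
  have "core.pow k M N \<le> star i j" for k
    using core_pow_le_pow[OF M N, of k] pow_le_kleene_star[OF I] by (meson order_trans)
  then show "core_star I A M N \<le> star i j"
    unfolding core_star_def kleene_star_def[of "core_index I A"]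
    by (intro max_sum_le) (auto simp: kleene_star_def max_sum_nonneg)
  have "pow k i j \<le> core_star I A M N" for k
    using pow_le_core_pow[OF M N, of k] core.pow_le_kleene_star[OF M(1) N(1), of k]
    unfolding core_star_def by linarith
  then show "star i j \<le> core_star I A M N"
    unfolding kleene_star_def[of I]
    by (intro max_sum_le) (auto simp: core_star_def kleene_star_def max_sum_nonneg)
qed

lemma star_same_comp: "N \<in> comps \<Longrightarrow> i \<in> N \<Longrightarrow> i' \<in> N \<Longrightarrow> j \<in> I \<Longrightarrow> star i j = star i' j"
  using core_index_cover[of j] core_star_eq
  by (metis (no_types, lifting) UnI1 core_index_def)

lemma star_nonneg: "0 \<le> star i j"
  by (simp add: kleene_star_def max_sum_nonneg)

section \<open>Powers of the matrix beyond the transient\<close>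

lemma mx_pow_pow: "i \<in> I \<Longrightarrow> j \<in> I \<Longrightarrow> mx_pow I (pow g) k i j = pow (k * g) i j"
proof (induction k arbitrary: j)
  case (Suc k)
  have "mx_pow I (pow g) (Suc k) i j = max_sum (\<lambda>l. pow (k * g) i l * pow g l j) I"
    by (auto simp: mx_mult_def Suc intro!: max_sum_cong)
  also have "\<dots> = pow (k * g + g) i j"
  proof (rule antisym)
    show "max_sum (\<lambda>l. pow (k * g) i l * pow g l j) I \<le> pow (k * g + g) i j"
      by (intro max_sum_le fin pow_nonneg pow_add_ge Suc)
    show "pow (k * g + g) i j \<le> max_sum (\<lambda>l. pow (k * g) i l * pow g l j) I"
      using pow_add_split[OF Suc.prems, of "k * g" g]
        max_sum_ge[OF fin, of _ "\<lambda>l. pow (k * g) i l * pow g l j"] by auto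
  qed
  finally show ?case by (simp add: add.commute)
qed simp

lemma subunit_pow: "subunit_mx I (pow g)"
  by unfold_locales (auto simp: fin pow_nonneg pow_le_one)

lemma pow_loop_mult: "i \<in> I \<Longrightarrow> pow m i i = 1 \<Longrightarrow> pow (q * m) i i = 1"
proof (induction q)
  case (Suc q)
  then have "1 \<le> pow (m + q * m) i i" using pow_add_ge[of i i m i "q * m"] by simp
  then show ?case using pow_le_one[of i i "m + q * m"] Suc.prems by (simp add: antisym)
qed (simp add: mx_id_def)

lemma closed_walk_unit_power:
  assumes g: "0 < g" and k: "k \<in> I"
  shows "(k, k) \<in> (subunit_mx.unit_edges I (pow g))\<^sup>+ \<longleftrightarrow> (\<exists>m>0. pow (m * g) k k = 1)"
  using subunit_mx.pow_eq_one_iff[OF subunit_pow k k] mx_pow_pow[OF k k]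
  by (auto simp: trancl_power)

text \<open>A closed unit walk of \<open>pow g\<close> unfolds to one of \<open>A\<close> whose
  length is a multiple of \<open>g\<close>. The loop is recorded because it later serves to lengthen
  walks.\<close>

lemma power_critical_node:
  assumes g: "0 < g" and k: "k \<in> critical_nodes I (pow g)"
  shows "k \<in> Nc \<and> (\<exists>m>0. pow (m * g) k k = 1)"
proof -
  interpret B: subunit_mx I "pow g" by (rule subunit_pow)
  obtain l where "(l, l) \<in> unit_edges\<^sup>+" using definite_closed_unit_walk[OF definite] by blast
  moreover from this have l: "l \<in> I" using unit_edges_subset(1) by (auto dest: tranclD)
  ultimately obtain m where m: "0 < m" "pow m l l = 1"
    by (auto simp: trancl_power pow_eq_one_iff)
  \<comment> \<open>Going \<open>g\<close> times round a closed unit walk of \<open>A\<close> yields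
    one of \<open>pow g\<close>, which is therefore definite.\<close>
  then have "pow (g * m) l l = 1" using l pow_loop_mult by blast
  then have "(l, l) \<in> B.unit_edges\<^sup>+"
    using closed_walk_unit_power[OF g l] m(1) by (auto simp: mult.commute)
  then have dB: "definite I (pow g)" by (rule B.closed_unit_walk_definite)
  have kk: "(k, k) \<in> B.unit_edges\<^sup>+"
    using k unfolding critical_nodes_def B.critical_edges_eq[OF dB]
    by (auto intro: rtrancl_into_trancl1 rtrancl_into_trancl2)
  then have kI: "k \<in> I" using B.unit_edges_subset(1) by (auto dest: tranclD)
  obtain m where m: "0 < m" "pow (m * g) k k = 1"
    using closed_walk_unit_power[OF g kI] kk by blast
  then have "(k, k) \<in> unit_edges ^^ (m * g)" "0 < m * g" using pow_eq_one_iff[OF kI kI] g by auto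
  then have "(k, k) \<in> unit_edges\<^sup>+" unfolding trancl_power by blast
  then obtain l where "(k, l) \<in> unit_edges" "(l, k) \<in> unit_edges\<^sup>*" by (meson tranclD)
  then have "(k, l) \<in> Ec" by (simp add: Ec_iff)
  then have "k \<in> Nc" using Ec_subset(2) by auto
  with m show ?thesis by blast
qed

end

section \<open>Entries of the power \<open>r\<close> past the transient\<close>

locale transient_mx = definite_mx +
  fixes T r :: nat
  assumes transient: "is_transient I A T" and r_ge: "T \<le> r" and r_dvd: "cyclicity I A dvd r"
begin

lemma pow_periodic: "i \<in> I \<Longrightarrow> j \<in> I \<Longrightarrow> T \<le> s \<Longrightarrow> pow (s + q * \<gamma>) i j = pow s i j"
proof (induction q)
  case (Suc q)
  have "pow ((s + q * \<gamma>) + \<gamma>) i j = pow (s + q * \<gamma>) i j"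
    using transient Suc.prems unfolding is_transient_def by simp
  moreover have "(s + q * \<gamma>) + \<gamma> = s + Suc q * \<gamma>" by simp
  ultimately show ?case using Suc by metis
qed simp

lemma pow_multiple:
  assumes "i \<in> I" "j \<in> I" "\<gamma> dvd m" "r \<le> m"
  shows "pow m i j = pow r i j"
proof -
  obtain q where "m - r = \<gamma> * q" using assms(3) r_dvd by (meson dvd_diff_nat dvd_def)
  then have "m = r + q * \<gamma>" using assms(4) by (simp add: mult.commute)
  then show ?thesis using pow_periodic[OF assms(1,2) r_ge] by simp
qed

text \<open>The length \<open>k\<close> may be less than \<open>r\<close> or fail to be divisible by
  \<open>\<gamma>\<close>; a lengthened walk with the same ends cures both, and periodicity returns
  to \<open>r\<close>.\<close>

lemma pow_walk_one:
  assumes N: "N \<in> comps" "i \<in> N" and w: "(i, j) \<in> Ec ^^ k" "comp_cyclicity I A N dvd k"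
  shows "pow r i j = 1"
proof -
  obtain m where m: "r \<le> m" "\<gamma> dvd m" "(i, j) \<in> Ec ^^ m"
    using long_critical_walk[OF N w] by blast
  have "(i, j) \<in> Ec\<^sup>*" using w(1) by (rule relpow_imp_rtrancl)
  then have I: "i \<in> I" "j \<in> I" using comp_reach[OF N] N comp_subset_I by auto
  have "(i, j) \<in> unit_edges ^^ m" using m(3) by (rule Ec_relpow_unit)
  then show ?thesis using pow_multiple[OF I m(2,1)] pow_eq_one_iff[OF I] by metis
qed

text \<open>A unit walk of length \<open>r\<close> between nodes of \<open>N\<close> is critical,
  and its length is a multiple of the cyclicity of \<open>N\<close>, which divides
  \<open>\<gamma>\<close>.\<close>

lemma pow_one_iff_class:
  assumes N: "N \<in> comps" "i \<in> N" "j \<in> N"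
  shows "pow r i j = 1 \<longleftrightarrow> j \<in> cyclic_class I A N i"
proof
  have I: "i \<in> I" "j \<in> I" using N comp_subset_I by auto
  assume "pow r i j = 1"
  then have "(i, j) \<in> unit_edges ^^ r" using pow_eq_one_iff[OF I] by simp
  moreover have "(j, i) \<in> unit_edges\<^sup>*" using comp_reach[OF N(1,3)] N(2) Ec_rtrancl_unit by blast
  ultimately have "(i, j) \<in> Ec ^^ r" by (rule unit_walk_critical)
  moreover have "comp_cyclicity I A N dvd r"
    using r_dvd dvd_Lcm[of "comp_cyclicity I A N" "comp_cyclicity I A ` comps"] N(1)
    by (auto simp: cyclicity_def intro: dvd_trans)
  ultimately show "j \<in> cyclic_class I A N i"
    using N by (auto simp: cyclic_class_def comp_path_iff cong_0_iff)
next
  assume "j \<in> cyclic_class I A N i"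
  then show "pow r i j = 1"
    using N pow_walk_one by (auto simp: cyclic_class_def comp_path_iff cong_0_iff)
qed

lemma class_subset: "N \<in> comps \<Longrightarrow> cyclic_class I A N i \<subseteq> N"
  using comp_reach by (auto simp: cyclic_class_def comp_path_iff dest: relpow_imp_rtrancl)

text \<open>A walk realizing the star may be too short; a closed unit walk of length
  \<open>r\<close> at the critical node \<open>i\<close> is put in front of it.\<close>

lemma pow_attains_star:
  assumes N: "N \<in> comps" "i \<in> N" and j: "j \<in> I"
  shows "\<exists>q. pow (r + q) i j = star i j"
proof -
  have I: "i \<in> I" using N comp_subset_I by auto
  obtain m where m: "star i j \<le> pow m i j"
    using star_attained[of i j] pow_nonneg by (metis order_refl)
  have "pow r i i * pow m i j \<le> pow (r + m) i j" by (rule pow_add_ge[OF j I])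
  \<comment> \<open>The empty walk, of length 0, already satisfies the divisibility
    condition.\<close>
  moreover have "pow r i i = 1" using pow_walk_one[OF N, of i 0] by simp
  ultimately have "star i j \<le> pow (r + m) i j" using m by simp
  moreover have "pow (r + m) i j \<le> star i j" by (rule pow_le_kleene_star[OF I j])
  ultimately show ?thesis by (meson antisym)
qed

text \<open>Row \<open>i\<close> itself may miss the value at power \<open>r\<close>, but another
  row of its component catches it. Through this every term of the star vector occurs in some
  side.\<close>

lemma column_attains_star:
  assumes N: "N \<in> comps" "i \<in> N" and j: "j \<in> I"
  shows "\<exists>i'\<in>N. pow r i' j = star i' j"
proof -
  have I: "i \<in> I" using N comp_subset_I by auto
  obtain q where q: "pow (r + q) i j = star i j" using pow_attains_star[OF assms] by blast
  \<comment> \<open>With \<open>(\<gamma> - 1) * q\<close> critical edges in front, the excess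
    \<open>q\<close> over \<open>r\<close> becomes \<open>q * \<gamma>\<close>, a whole number of
    periods.\<close>
  obtain i' where i': "i' \<in> N" "(i', i) \<in> Ec ^^ ((\<gamma> - 1) * q)"
    using comp_predecessor[OF N] by blast
  have I': "i' \<in> I" using N i' comp_subset_I by auto
  have "pow ((\<gamma> - 1) * q) i' i = 1"
    using Ec_relpow_unit[OF i'(2)] pow_eq_one_iff[OF I' I] by blast
  then have "star i j \<le> pow ((\<gamma> - 1) * q + (r + q)) i' j"
    using pow_add_ge[OF j I, of "(\<gamma> - 1) * q" i' "r + q"] q by simp
  also have "(\<gamma> - 1) * q + (r + q) = r + q * \<gamma>" using cyclicity_pos by (cases \<gamma>) auto
  also have "pow (r + q * \<gamma>) i' j = pow r i' j" by (rule pow_periodic[OF I' j r_ge])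
  finally have "star i' j \<le> pow r i' j" using star_same_comp[OF N i'(1) j] by simp
  then show ?thesis using i'(1) pow_le_kleene_star[OF I' j] by (meson antisym)
qed

text \<open>The star factors in \<open>Q_mx\<close> come from powers \<open>s * \<gamma>\<close>
  with \<open>s\<close> not controlled. A long unit loop at the critical node \<open>k\<close> pads
  both factors, and periodicity reduces them to power \<open>r\<close>.\<close>

lemma pow_through_critical:
  assumes i: "i \<in> I" and j: "j \<in> I" and nz: "pow r i j \<noteq> 0"
  shows "\<exists>k\<in>Nc. pow r i j \<le> pow r i k * pow r k j"
proof -
  interpret B: subunit_mx I "pow \<gamma>" by (rule subunit_pow)
  obtain t where t: "r = t * \<gamma>" using r_dvd by (auto simp: dvd_def mult.commute)
  have Q: "pow r i j = Q_mx I (pow \<gamma>) i j"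
    using transient r_ge i j unfolding is_transient_def t by blast
  have finN: "finite (critical_nodes I (pow \<gamma>))"
    by (rule finite_subset[OF _ fin]) (use power_critical_node[OF cyclicity_pos] Nc_subset in blast)
  obtain k where k: "k \<in> critical_nodes I (pow \<gamma>)"
    and eq: "kleene_star I (pow \<gamma>) i k * kleene_star I (pow \<gamma>) k j = pow r i j"
    using max_sum_attained[OF finN] nz unfolding Q Q_mx_def by blast
  obtain m where m: "0 < m" "pow (m * \<gamma>) k k = 1" and kN: "k \<in> Nc"
    using power_critical_node[OF cyclicity_pos k] by blast
  have kI: "k \<in> I" using kN Nc_subset by auto
  \<comment> \<open>Traversing the loop \<open>r\<close> times makes it at least \<open>r\<close>
    long.\<close>
  have loop: "pow (r * (m * \<gamma>)) k k = 1" using pow_loop_mult[OF kI m(2)] .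
  have long: "r \<le> r * (m * \<gamma>)" using m(1) cyclicity_pos by simp
  have "pow (s * \<gamma>) k j \<le> pow r k j" for s
  proof -
    have "pow (s * \<gamma>) k j \<le> pow (r * (m * \<gamma>) + s * \<gamma>) k j"
      using pow_add_ge[OF j kI, of "r * (m * \<gamma>)" k "s * \<gamma>"] loop by simp
    also have "\<dots> = pow r k j" using long r_dvd by (intro pow_multiple kI j trans_le_add1) auto
    finally show ?thesis .
  qed
  then have 1: "kleene_star I (pow \<gamma>) k j \<le> pow r k j"
    by (auto simp: kleene_star_def mx_pow_pow kI j pow_nonneg intro!: max_sum_le)
  have "pow (s * \<gamma>) i k \<le> pow r i k" for s
  proof -
    have "pow (s * \<gamma>) i k \<le> pow (s * \<gamma> + r * (m * \<gamma>)) i k"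
      using pow_add_ge[OF kI kI, of "s * \<gamma>" i "r * (m * \<gamma>)"] loop by simp
    also have "\<dots> = pow r i k" using long r_dvd by (intro pow_multiple kI i trans_le_add2) auto
    finally show ?thesis .
  qed
  then have 2: "kleene_star I (pow \<gamma>) i k \<le> pow r i k"
    by (auto simp: kleene_star_def mx_pow_pow kI i pow_nonneg intro!: max_sum_le)
  have "0 \<le> kleene_star I (pow \<gamma>) k j" by (simp add: kleene_star_def max_sum_nonneg)
  then have "pow r i j \<le> pow r i k * pow r k j"
    unfolding eq[symmetric] by (intro mult_mono 1 2 pow_nonneg)
  then show ?thesis using kN by blast
qed

end

section \<open>The two sides of the system\<close>

context transient_mx
begin

lemma finite_class: "N \<in> comps \<Longrightarrow> finite (cyclic_class I A N i)"
  using class_subset comp_subset_I fin by (meson finite_subset)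

lemma finite_M_set: "N' \<in> comps \<Longrightarrow> finite (M_set I A r N N' i)"
  using comp_subset_I fin by (metis (no_types, lifting) M_set_def finite_subset mem_Collect_eq subsetI)

lemma finite_K_set: "finite (K_set I A r N i)"
  using fin by (simp add: K_set_def)

lemma comp_core_index: "N \<in> comps \<Longrightarrow> N \<in> core_index I A"
  "t \<in> I - Nc \<Longrightarrow> {t} \<in> core_index I A"
  by (auto simp: core_index_def)

lemma star_le_one: "i \<in> I \<Longrightarrow> j \<in> I \<Longrightarrow> star i j \<le> 1"
  using star_attained[of i j] pow_le_one by (metis zero_le_one)

lemma star_in_comp: "N \<in> comps \<Longrightarrow> i \<in> N \<Longrightarrow> j \<in> N \<Longrightarrow> star i j = 1"
proof (rule antisym)
  assume N: "N \<in> comps" "i \<in> N" "j \<in> N"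
  then have I: "i \<in> I" "j \<in> I" using comp_subset_I by auto
  show "star i j \<le> 1" by (rule star_le_one[OF I])
  show "1 \<le> star i j"
    using core_index_linked[OF comp_core_index(1)[OF N(1)] N(2,3)] pow_le_kleene_star[OF I] by metis
qed

section \<open>Sides, powers and the star applied to a nonnegative vector\<close>

context
  fixes x :: "'a \<Rightarrow> real"
  assumes x: "\<And>k. k \<in> I \<Longrightarrow> 0 \<le> x k"
begin

abbreviation side where "side \<equiv> class_side I A r x"
abbreviation star_vec where "star_vec \<equiv> mx_vec I star x"

lemma star_vec_ge: "j \<in> I \<Longrightarrow> star i j * x j \<le> star_vec i"
  unfolding mx_vec_def by (rule max_sum_ge[OF fin])

lemma pow_vec_le_star_vec: "i \<in> I \<Longrightarrow> mx_vec I (pow m) x i \<le> star_vec i"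
  unfolding mx_vec_def[of I "pow m"]
  by (rule max_sum_le[OF fin vec_nonneg])
    (meson mult_right_mono order_trans pow_le_kleene_star star_vec_ge x)

lemma star_vec_comp: "N \<in> comps \<Longrightarrow> i \<in> N \<Longrightarrow> j \<in> N \<Longrightarrow> star_vec i = star_vec j"
  unfolding mx_vec_def by (rule max_sum_cong) (auto simp: star_same_comp[of N i j])

lemma side_nonneg: "N \<in> comps \<Longrightarrow> 0 \<le> side N i"
  unfolding class_side_def by (simp add: le_max_iff_disj max_sum_nonneg finite_K_set)

text \<open>Every term of the side is a term of the product with \<open>pow r\<close>: class entries
  have coefficient 1, and the sets \<open>M_set\<close> and \<open>K_set\<close> select entries
  equal to the core star.\<close>

lemma side_le_vec:
  assumes N: "N \<in> comps" "i \<in> N"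
  shows "side N i \<le> mx_vec I (pow r) x i"
proof -
  let ?v = "mx_vec I (pow r) x i"
  have v: "0 \<le> ?v" by (rule vec_nonneg)
  have "max_sum x (cyclic_class I A N i) \<le> ?v"
  proof (rule max_sum_le[OF finite_class[OF N(1)] v])
    fix k assume k: "k \<in> cyclic_class I A N i"
    then have "k \<in> N" "k \<in> I" using class_subset comp_subset_I N by blast+
    moreover from this have "pow r i k = 1" using pow_one_iff_class[OF N] k by blast
    ultimately show "x k \<le> ?v" using vec_ge[of k r i x] by simp
  qed
  moreover have "core_star I A N N' * max_sum x (M_set I A r N N' i) \<le> ?v"
    if N': "N' \<in> comps - {N}" for N'
  proof (cases "max_sum x (M_set I A r N N' i) = 0")
    case False
    then obtain k where k: "k \<in> M_set I A r N N' i" "x k = max_sum x (M_set I A r N N' i)"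
      using max_sum_attained[OF finite_M_set] N' by blast
    then have "k \<in> I" "pow r i k = core_star I A N N'"
      using N' comp_subset_I by (auto simp: M_set_def)
    then show ?thesis using vec_ge[of k r i x] k(2) by simp
  qed (simp add: v)
  moreover have "max_sum (\<lambda>t. core_star I A N {t} * x t) (K_set I A r N i) \<le> ?v"
  proof (rule max_sum_le[OF finite_K_set v])
    fix t assume "t \<in> K_set I A r N i"
    then have "t \<in> I" "pow r i t = core_star I A N {t}" by (auto simp: K_set_def)
    then show "core_star I A N {t} * x t \<le> ?v" using vec_ge[of t r i x] by simp
  qed
  ultimately show ?thesis
    unfolding class_side_def by (auto intro!: max_sum_le simp: v finite_comps)
qed

text \<open>Wherever \<open>j\<close> lies, attaining the star puts it into the matching index set.
  Within \<open>N\<close> the star is 1, so there it means membership in the cyclic class.\<close>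

lemma side_ge:
  assumes N: "N \<in> comps" "i \<in> N" and j: "j \<in> I" and eq: "pow r i j = star i j"
  shows "star i j * x j \<le> side N i"
proof (cases "j \<in> Nc")
  case True
  then obtain N' where N': "N' \<in> comps" "j \<in> N'" using node_in_comp by blast
  show ?thesis
  proof (cases "N' = N")
    case True
    then have "star i j = 1" using star_in_comp N N' by blast
    moreover from this have "j \<in> cyclic_class I A N i"
      using eq pow_one_iff_class N N' True by simp
    then have "x j \<le> max_sum x (cyclic_class I A N i)" by (rule max_sum_ge[OF finite_class[OF N(1)]])
    ultimately show ?thesis by (simp add: class_side_def)
  next
    case False
    have star: "core_star I A N N' = star i j"
      by (intro core_star_eq comp_core_index N N')
    then have "j \<in> M_set I A r N N' i" using N' eq by (simp add: M_set_def)
    then have "x j \<le> max_sum x (M_set I A r N N' i)" by (rule max_sum_ge[OF finite_M_set[OF N'(1)]])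
    then have "star i j * x j \<le> core_star I A N N' * max_sum x (M_set I A r N N' i)"
      unfolding star by (rule mult_left_mono) (rule star_nonneg)
    also have "\<dots> \<le> max_sum (\<lambda>N'. core_star I A N N' * max_sum x (M_set I A r N N' i)) (comps - {N})"
      using N' False finite_comps
        max_sum_ge[of "comps - {N}" N' "\<lambda>N'. core_star I A N N' * max_sum x (M_set I A r N N' i)"]
      by simp
    finally show ?thesis by (simp add: class_side_def)
  qed
next
  case False
  then have t: "{j} \<in> core_index I A" using j comp_core_index(2) by blast
  have star: "core_star I A N {j} = star i j"
    by (intro core_star_eq comp_core_index t N) simp
  then have "j \<in> K_set I A r N i" using j False eq by (simp add: K_set_def)
  then have "star i j * x j \<le> max_sum (\<lambda>t. core_star I A N {t} * x t) (K_set I A r N i)"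
    using max_sum_ge[OF finite_K_set, of j N i "\<lambda>t. core_star I A N {t} * x t"] star by simp
  then show ?thesis by (simp add: class_side_def)
qed

text \<open>A term dropped from the side is strictly dominated in \<open>star_vec\<close>, so it cannot attain the maximum.\<close>

lemma side_eq_star_vec:
  assumes N: "N \<in> comps" "i \<in> N" and eq: "mx_vec I (pow r) x i = star_vec i"
  shows "side N i = star_vec i"
proof (rule antisym)
  have I: "i \<in> I" using N comp_subset_I by auto
  show "side N i \<le> star_vec i" using side_le_vec[OF N] eq by simp
  show "star_vec i \<le> side N i"
  proof (cases "star_vec i = 0")
    case True
    then show ?thesis using side_nonneg N by simp
  next
    case False
    then obtain j where j: "j \<in> I" "pow r i j * x j = star_vec i"
      using max_sum_attained[OF fin, of "\<lambda>j. pow r i j * x j"] eq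
      unfolding mx_vec_def[of I "pow r"] by auto
    \<comment> \<open>Positivity of \<open>x j\<close> allows its cancellation, so the maximizing
      index attains the star.\<close>
    have xj: "0 < x j" using False j x[OF j(1)] by (cases "x j = 0") auto
    have "star i j * x j \<le> pow r i j * x j" using star_vec_ge[OF j(1), of i] j(2) by simp
    then have "pow r i j = star i j" using xj pow_le_kleene_star[OF I j(1), of r] by (intro antisym) auto
    then show ?thesis using side_ge[OF N j(1)] j(2) by simp
  qed
qed

text \<open>Each term of the star vector appears in the side of some row of \<open>N\<close>, hence
  in the common value.\<close>

lemma equal_sides_vec:
  assumes N: "N \<in> comps" "i \<in> N" and eq: "\<And>j. j \<in> N \<Longrightarrow> side N j = side N i"
  shows "mx_vec I (pow r) x i = star_vec i"
proof (rule antisym)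
  show "mx_vec I (pow r) x i \<le> star_vec i"
    using pow_vec_le_star_vec N comp_subset_I by blast
  have "star_vec i \<le> side N i"
    unfolding mx_vec_def
  proof (rule max_sum_le[OF fin side_nonneg[OF N(1)]])
    fix j assume j: "j \<in> I"
    obtain i' where i': "i' \<in> N" "pow r i' j = star i' j"
      using column_attains_star[OF N j] by blast
    then show "star i j * x j \<le> side N i"
      using side_ge[OF N(1) i'(1) j i'(2)] star_same_comp[OF N i'(1) j] eq[OF i'(1)] by simp
  qed
  then show "star_vec i \<le> mx_vec I (pow r) x i" using side_le_vec[OF N] by linarith
qed

text \<open>Equality of two consecutive iterates propagates to all later ones, and every star entry
  of row \<open>i\<close> is attained in one of these powers.\<close>

lemma stationary_vec:
  assumes eq: "\<And>i. i \<in> I \<Longrightarrow> mx_vec I (pow r) x i = mx_vec I (pow (r + 1)) x i"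
    and N: "N \<in> comps" "i \<in> N"
  shows "mx_vec I (pow r) x i = star_vec i"
proof (rule antisym)
  have I: "i \<in> I" using N comp_subset_I by auto
  have shift: "mx_vec I (pow (r + q)) x k = mx_vec I (pow r) x k" if k: "k \<in> I" for q k
  proof (induction q)
    case (Suc q)
    have "mx_vec I (pow (q + (r + 1))) x k = mx_vec I (pow q) (mx_vec I (pow (r + 1)) x) k"
      by (rule vec_add[OF x k])
    also have "\<dots> = mx_vec I (pow q) (mx_vec I (pow r) x) k"
      unfolding mx_vec_def[of I "pow q"] by (rule max_sum_cong) (use eq in auto)
    also have "\<dots> = mx_vec I (pow (q + r)) x k" by (rule vec_add[OF x k, symmetric])
    finally show ?case using Suc.IH by (simp add: ac_simps del: mx_pow.simps)
  qed simp
  show "mx_vec I (pow r) x i \<le> star_vec i" by (rule pow_vec_le_star_vec[OF I])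
  show "star_vec i \<le> mx_vec I (pow r) x i"
    unfolding mx_vec_def[of I star]
  proof (rule max_sum_le[OF fin vec_nonneg])
    fix j assume j: "j \<in> I"
    obtain q where "pow (r + q) i j = star i j" using pow_attains_star[OF N j] by blast
    then show "star i j * x j \<le> mx_vec I (pow r) x i"
      using vec_ge[OF j, of "r + q" i x] shift[OF I] by simp
  qed
qed

end

section \<open>From critical rows to all rows\<close>

lemma vec_through_critical:
  assumes y: "\<And>k. k \<in> I \<Longrightarrow> 0 \<le> y k" and i: "i \<in> I" and c: "0 \<le> c"
    and le: "\<And>k. k \<in> Nc \<Longrightarrow> pow r i k * mx_vec I (pow r) y k \<le> c"
  shows "mx_vec I (pow r) y i \<le> c"
  unfolding mx_vec_def
proof (rule max_sum_le[OF fin c])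
  fix j assume j: "j \<in> I"
  show "pow r i j * y j \<le> c"
  proof (cases "pow r i j = 0")
    case False
    obtain k where k: "k \<in> Nc" "pow r i j \<le> pow r i k * pow r k j"
      using pow_through_critical[OF i j False] by blast
    have "pow r i j * y j \<le> pow r i k * (pow r k j * y j)"
      using mult_right_mono[OF k(2) y[OF j]] by (simp add: mult.assoc)
    also have "\<dots> \<le> pow r i k * mx_vec I (pow r) y k"
      by (intro mult_left_mono vec_ge j pow_nonneg)
    also have "\<dots> \<le> c" by (rule le[OF k(1)])
    finally show ?thesis .
  qed (simp add: c)
qed

text \<open>A shift by \<open>r\<close> is a whole number of periods, so \<open>pow r\<close> fixes
  all iterates from \<open>r\<close> on.\<close>

lemma vec_multiple_absorb:
  assumes i: "i \<in> I"
  shows "mx_vec I (pow (r + (r + s))) x i = mx_vec I (pow (r + s)) x i"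
proof -
  obtain q where q: "r = q * \<gamma>" using r_dvd by (metis dvd_def mult.commute)
  have "pow (r + (r + s)) i j = pow (r + s) i j" if j: "j \<in> I" for j
    using pow_periodic[OF i j, of "r + s" q] r_ge q by (simp add: ac_simps)
  then show ?thesis unfolding mx_vec_def by (intro max_sum_cong) auto
qed

lemma vec_eq_if_critical_eq:
  assumes x: "\<And>k. k \<in> I \<Longrightarrow> 0 \<le> x k" and i: "i \<in> I"
    and eq: "\<And>k. k \<in> Nc \<Longrightarrow> mx_vec I (pow r) x k = mx_vec I (pow (r + 1)) x k"
  shows "mx_vec I (pow r) x i = mx_vec I (pow (r + 1)) x i"
proof (rule antisym)
  have absorb: "pow r i k * mx_vec I (pow (r + s)) x k \<le> mx_vec I (pow (r + s)) x i"
    if k: "k \<in> Nc" for k s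
  proof -
    have "pow r i k * mx_vec I (pow (r + s)) x k \<le> mx_vec I (pow r) (mx_vec I (pow (r + s)) x) i"
      using vec_ge k Nc_subset by blast
    also have "\<dots> = mx_vec I (pow (r + (r + s))) x i" by (rule vec_add[OF x i, symmetric])
    finally show ?thesis by (simp only: vec_multiple_absorb[OF i])
  qed
  show "mx_vec I (pow r) x i \<le> mx_vec I (pow (r + 1)) x i"
    by (rule vec_through_critical[OF x i vec_nonneg]) (use absorb[of _ 1] eq in auto)
  \<comment> \<open>Writing the next iterate as \<open>pow r\<close> applied to \<open>A\<close>
    times \<open>x\<close> permits the same factorization through critical nodes, with a new
    vector.\<close>
  have split: "mx_vec I (pow (r + 1)) x k = mx_vec I (pow r) (mx_vec I (pow 1) x) k" if "k \<in> I" for k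
    by (rule vec_add[OF x that])
  show "mx_vec I (pow (r + 1)) x i \<le> mx_vec I (pow r) x i"
    unfolding split[OF i]
  proof (rule vec_through_critical[OF vec_nonneg i vec_nonneg])
    fix k assume k: "k \<in> Nc"
    then have "mx_vec I (pow r) (mx_vec I (pow 1) x) k = mx_vec I (pow r) x k"
      using eq[OF k] split Nc_subset by auto
    then show "pow r i k * mx_vec I (pow r) (mx_vec I (pow 1) x) k \<le> mx_vec I (pow r) x i"
      using absorb[OF k, of 0] by simp
  qed
qed

section \<open>Equivalence of the two systems\<close>

theorem power_system_iff:
  assumes x: "\<And>k. k \<in> I \<Longrightarrow> 0 \<le> x k"
  shows "(\<forall>i\<in>I. mx_vec I (pow r) x i = mx_vec I (pow (r + 1)) x i) \<longleftrightarrow>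
    (\<forall>N\<in>comps. \<forall>i\<in>N. \<forall>j\<in>N.
       class_access I A N 1 (cyclic_class I A N i) (cyclic_class I A N j) \<longrightarrow>
       class_side I A r x N i = class_side I A r x N j)" (is "?L \<longleftrightarrow> ?R")
proof
  assume L: ?L
  have side: "class_side I A r x N i = mx_vec I star x i" if "N \<in> comps" "i \<in> N" for N i
    using side_eq_star_vec[OF x that stationary_vec[OF x bspec[OF L] that]] .
  show ?R
  proof (intro ballI impI)
    fix N i j
    assume N: "N \<in> comps" "i \<in> N" "j \<in> N"
    have "mx_vec I star x i = mx_vec I star x j" by (rule star_vec_comp[OF x N])
    then show "class_side I A r x N i = class_side I A r x N j"
      unfolding side[OF N(1,2)] side[OF N(1,3)] .
  qed
next
  assume R: ?R
  \<comment> \<open>A critical edge witnesses one-step access between the classes of its ends, so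
    the assumed equations hold along edges and then throughout \<open>N\<close>.\<close>
  have edge: "class_side I A r x N i = class_side I A r x N j"
    if N: "N \<in> comps" "i \<in> N" "j \<in> N" "(i, j) \<in> Ec" for N i j
  proof -
    have "u \<in> cyclic_class I A N u" if "u \<in> N" for u
      using that N(1) by (auto simp: cyclic_class_def comp_path_iff intro!: exI[of _ 0])
    moreover have "comp_path I A N 1 i j"
      using N by (auto simp: comp_path_iff intro!: exI[of _ 1])
    ultimately have "class_access I A N 1 (cyclic_class I A N i) (cyclic_class I A N j)"
      using N by (auto simp: class_access_def)
    then show ?thesis using R N by blast
  qed
  have const: "class_side I A r x N j = class_side I A r x N i"
    if N: "N \<in> comps" "i \<in> N" "j \<in> N" for N i j
  proof -
    have "(i, j) \<in> Ec\<^sup>*" using comp_reach N by blast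
    then show ?thesis
    proof (induction rule: rtrancl_induct)
      case (step k l)
      then have "k \<in> N" "l \<in> N" using comp_reach[OF N(1,2)] by (auto intro: rtrancl_into_rtrancl)
      then show ?case using edge[OF N(1)] step by metis
    qed simp
  qed
  have sv: "mx_vec I (pow r) x i = mx_vec I star x i" if N: "N \<in> comps" "i \<in> N" for N i
    by (rule equal_sides_vec[OF x N const[OF N]])
  have crit: "mx_vec I (pow r) x i = mx_vec I (pow (r + 1)) x i" if i: "i \<in> Nc" for i
  proof -
    obtain N where N: "N \<in> comps" "i \<in> N" using node_in_comp i by blast
    have I: "i \<in> I" using i Nc_subset by auto
    obtain j where j: "j \<in> N" "(i, j) \<in> Ec" using comp_edges(1)[OF N] by blast
    have jI: "j \<in> I" using j N comp_subset_I by auto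
    have "pow 1 i j = 1" using j(2) Ec_subset(1) pow_one[OF I jI] by (auto simp: unit_edges_def)
    \<comment> \<open>A critical edge out of \<open>i\<close> has weight 1, so the next iterate at
      \<open>i\<close> is at least the iterate at \<open>j\<close>, which is the star value shared
      by the whole component.\<close>
    then have "mx_vec I (pow r) x j \<le> mx_vec I (pow 1) (mx_vec I (pow r) x) i"
      using vec_ge[OF jI, of 1 i "mx_vec I (pow r) x"] by simp
    also have "\<dots> = mx_vec I (pow (r + 1)) x i"
      using vec_add[OF x I, where a = 1 and b = r] by (simp add: add.commute del: mx_pow.simps)
    finally have "mx_vec I (pow r) x i \<le> mx_vec I (pow (r + 1)) x i"
      using sv[OF N] sv[OF N(1) j(1)] star_vec_comp[OF x N j(1)] by simp
    moreover have "mx_vec I (pow (r + 1)) x i \<le> mx_vec I (pow r) x i"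
      using pow_vec_le_star_vec[OF x I, where m = "r + 1"] sv[OF N] by simp
    ultimately show ?thesis by (rule antisym)
  qed
  show ?L
  proof
    fix i assume i: "i \<in> I"
    show "mx_vec I (pow r) x i = mx_vec I (pow (r + 1)) x i"
      by (rule vec_eq_if_critical_eq[OF _ i crit]) (rule x)
  qed
qed

end

theorem theorem6p2:
  fixes n c r T :: nat and A :: "nat \<Rightarrow> nat \<Rightarrow> real" and x :: "nat \<Rightarrow> real"
  assumes nonneg: "\<And>i j. i \<in> {1..n} \<Longrightarrow> j \<in> {1..n} \<Longrightarrow> A i j \<ge> 0"
    and irred: "irreducible_mx {1..n} A"
    and vis: "visualized {1..n} A"
    and crit: "critical_nodes {1..n} A = {1..c}"
    and T: "is_transient {1..n} A T"
    and r: "r \<ge> T" "cyclicity {1..n} A dvd r"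
    and x: "\<And>i. i \<in> {1..n} \<Longrightarrow> x i \<ge> 0"
  shows "(\<forall>i\<in>{1..n}. mx_vec {1..n} (mx_pow {1..n} A r) x i
                     = mx_vec {1..n} (mx_pow {1..n} A (r + 1)) x i) \<longleftrightarrow>
    (\<forall>N\<in>critical_comps {1..n} A. \<forall>i\<in>N. \<forall>j\<in>N.
       class_access {1..n} A N 1 (cyclic_class {1..n} A N i) (cyclic_class {1..n} A N j) \<longrightarrow>
       class_side {1..n} A r x N i = class_side {1..n} A r x N j)"
proof -
  interpret transient_mx "{1..n}" A T r
    by unfold_locales (use nonneg vis T r in \<open>auto simp: visualized_def\<close>)
  show ?thesis by (rule power_system_iff) (fact x)
qed

end
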